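(* Let $M$ be a smooth manifold, $\mathcal{G}\subset T^*M$ a tubular neighborhood of the zero section and $\xi\in\Omega^1(\mathcal{G})$. Then the space $(J_\xi^\infty,\triangleright)$ (defined in the context) is a pre-Lie algebra, that is, for all $f,g,h\in J_\xi^\infty$, $$(f\triangleright g)\triangleright h-f\triangleright (g\triangleright h)=(g\triangleright f)\triangleright h-g\triangleright (f\triangleright h).$$
   Context: $\pi\colon T^*M\to M$ is the cotangent projection and $\omega$ the canonical symplectic form on $\mathcal{G}\subset T^*M$. Sign convention: $\omega=\sum_i dp_i\wedge dq^i$; for a 1-form $\zeta$ on $\mathcal{G}$, $X_\zeta$ is the vector field with $\iota_{X_\zeta}\omega=-\zeta$; $\{f,g\}_\omega=X_{df}(g)=\omega(X_{df},X_{dg})$. The Lie algebroid bracket on 1-forms on $\mathcal{G}$ is $$[\zeta_1,\zeta_2]=\mathcal{L}_{X_{\zeta_1}}\zeta_2-\mathcal{L}_{X_{\zeta_2}}\zeta_1-d\,\omega(X_{\zeta_1},X_{\zeta_2}),$$ so that $[df,dg]=d\{f,g\}_\omega$. $\Omega^{1,\mathcal{G}}(M)=\{\zeta\in\Omega^1(M):\mathrm{Graph}(\zeta)\subset\mathcal{G}\}$, and $\mathcal{E}$ is the real vector space of all maps $\Omega^{1,\mathcal{G}}(M)\to\Omega^1(M)$. The form $\xi$ is regarded as the element $\zeta\mapsto\zeta^*\xi$ of $\mathcal{E}$ (a 1-form $\zeta$ on $M$ being viewed as a section $M\to\mathcal{G}\subset T^*M$), still denoted $\xi$. For $k\ge1$,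 $\eta_k\colon\mathcal{E}^{\otimes k}\to\mathcal{E}$ is the map $$\eta_k(f_1,\dots,f_k)(\zeta)=\zeta^*[\dots[\xi,\pi^*f_k(\zeta)],\dots,\pi^*f_1(\zeta)].$$ $J_\xi^\infty\subset\mathcal{E}$ is the smallest real vector subspace containing $\xi$ and such that $\eta_k\bigl((J_\xi^\infty)^{\otimes k}\bigr)\subset J_\xi^\infty$ for all $k\ge1$. The bilinear product $\triangleright$ on $J_\xi^\infty$ is defined by $h\triangleright\xi=\eta_1(h)$ and extended by linearity and the Leibniz rule: for $k\ge1$ and $h,f_1,\dots,f_k\in J_\xi^\infty$, $$h\triangleright\eta_k(f_1,\dots,f_k)=\sum_{i=1}^k\eta_k(f_1,\dots,h\triangleright f_i,\dots,f_k)+\eta_{k+1}(h,f_1,\dots,f_k).$$ *)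

theory Defs
  imports "HOL-Analysis.Analysis" "HOL-Library.Function_Algebras"
begin

section \<open>Smooth manifolds\<close>

text \<open>The second argument of \<open>Ck_on\<close> is meant to be an open set, the model space
  finite-dimensional.\<close>

primrec Ck_on :: "nat \<Rightarrow> 'e::real_normed_vector set \<Rightarrow> ('e \<Rightarrow> 'f::real_normed_vector) \<Rightarrow> bool" where
  "Ck_on 0 S f \<longleftrightarrow> continuous_on S f"
| "Ck_on (Suc k) S f \<longleftrightarrow>
     (\<forall>y\<in>S. f differentiable (at y)) \<and> (\<forall>v. Ck_on k S (\<lambda>y. frechet_derivative f (at y) v))"

definition smooth_on :: "'e::real_normed_vector set \<Rightarrow> ('e \<Rightarrow> 'f::real_normed_vector) \<Rightarrow> bool" where
  "smooth_on S f \<longleftrightarrow> (\<forall>k. Ck_on k S f)"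

text \<open>A chart is a pair of its domain and a coordinate map (whose values off the domain are
  irrelevant).  A manifold is given by an atlas; its points are those covered by the charts.\<close>

type_synonym ('a, 'e) chart = "'a set \<times> ('a \<Rightarrow> 'e)"

definition pts :: "('a, 'e) chart set \<Rightarrow> 'a set" where
  "pts A = (\<Union>c\<in>A. fst c)"

definition charts_at :: "('a, 'e) chart set \<Rightarrow> 'a \<Rightarrow> ('a, 'e) chart set" where
  "charts_at A x = {c \<in> A. x \<in> fst c}"

definition chart_inv :: "('a, 'e) chart \<Rightarrow> 'e \<Rightarrow> 'a" where
  "chart_inv c = inv_into (fst c) (snd c)"

definition transition :: "('a, 'e) chart \<Rightarrow> ('a, 'e) chart \<Rightarrow> 'e \<Rightarrow> 'e" where
  "transition c d = snd d \<circ> chart_inv c"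

definition smooth_atlas :: "('a, 'e::real_normed_vector) chart set \<Rightarrow> bool" where
  "smooth_atlas A \<longleftrightarrow>
     (\<forall>c\<in>A. inj_on (snd c) (fst c) \<and> open (snd c ` fst c)) \<and>
     (\<forall>c\<in>A. \<forall>d\<in>A. open (snd c ` (fst c \<inter> fst d)) \<and>
                      smooth_on (snd c ` (fst c \<inter> fst d)) (transition c d))"

definition atlas_open :: "('a, 'e::real_normed_vector) chart set \<Rightarrow> 'a set \<Rightarrow> bool" where
  "atlas_open A W \<longleftrightarrow> W \<subseteq> pts A \<and> (\<forall>c\<in>A. open (snd c ` (W \<inter> fst c)))"

definition atlas_topology :: "('a, 'e::real_normed_vector) chart set \<Rightarrow> 'a topology" where
  "atlas_topology A = topology (atlas_open A)"

lemma istopology_atlas_open: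
  assumes "smooth_atlas A"
  shows "istopology (atlas_open A)"
  unfolding istopology_def
proof (intro conjI allI impI)
  fix S T assume S: "atlas_open A S" and T: "atlas_open A T"
  have "snd c ` (S \<inter> T \<inter> fst c) = snd c ` (S \<inter> fst c) \<inter> snd c ` (T \<inter> fst c)" if "c \<in> A" for c
    using assms that unfolding smooth_atlas_def inj_on_def by blast
  then show "atlas_open A (S \<inter> T)"
    using S T unfolding atlas_open_def by (auto intro: open_Int)
next
  fix K assume K: "\<forall>S\<in>K. atlas_open A S"
  have "snd c ` (\<Union> K \<inter> fst c) = (\<Union>S\<in>K. snd c ` (S \<inter> fst c))" for c :: "('a, 'b) chart"
    by blast
  then show "atlas_open A (\<Union> K)"
    using K unfolding atlas_open_def by (auto intro!: open_UN)
qed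

lemma openin_atlas_topology:
  "smooth_atlas A \<Longrightarrow> openin (atlas_topology A) W \<longleftrightarrow> atlas_open A W"
  by (simp add: atlas_topology_def istopology_atlas_open topology_inverse')

text \<open>The model space is any finite-dimensional Euclidean space; the class \<open>euclidean_space\<close>
  would exclude dimension 0.\<close>

definition smooth_manifold :: "('a, 'e::real_inner) chart set \<Rightarrow> bool" where
  "smooth_manifold A \<longleftrightarrow>
     (\<exists>B :: 'e set. finite B \<and> span B = UNIV) \<and>
     smooth_atlas A \<and> Hausdorff_space (atlas_topology A) \<and> second_countable (atlas_topology A)"

text \<open>Smoothness of a map between open subsets \<open>U\<close>, \<open>V\<close> of manifolds.  The openness clause
  expresses continuity.\<close>

definition smooth_map ::
  "('a, 'e::real_normed_vector) chart set \<Rightarrow> 'a set \<Rightarrow>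
   ('b, 'f::real_normed_vector) chart set \<Rightarrow> 'b set \<Rightarrow> ('a \<Rightarrow> 'b) \<Rightarrow> bool" where
  "smooth_map A U B V f \<longleftrightarrow> f ` U \<subseteq> V \<and>
     (\<forall>c\<in>A. \<forall>d\<in>B. open (snd c ` (fst c \<inter> U \<inter> f -` fst d)) \<and>
        smooth_on (snd c ` (fst c \<inter> U \<inter> f -` fst d)) (snd d \<circ> f \<circ> chart_inv c))"


section \<open>Covectors, 1-forms and their calculus\<close>

text \<open>A tangent or cotangent vector at \<open>x\<close> is the family of its components in all charts around
  \<open>x\<close>, extended by 0 to the other charts.  Components of a covector \<open>\<alpha>\<close> are taken with respect
  to the inner product: in the chart \<open>c\<close> its value on the vector with components \<open>v\<close> is
  \<open>\<alpha> c \<bullet> v\<close>.  Accordingly \<open>adjoint\<close> pulls back covectors along linear maps, and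
  \<open>adjoint L 1\<close> is the component vector of a functional \<open>L\<close>.\<close>

type_synonym ('a, 'e) vec = "('a, 'e) chart \<Rightarrow> 'e"
type_synonym ('a, 'e) field = "'a \<Rightarrow> ('a, 'e) vec"

definition cotangent_space :: "('a, 'e::real_inner) chart set \<Rightarrow> 'a \<Rightarrow> ('a, 'e) vec set" where
  "cotangent_space A x =
     {\<alpha>. (\<forall>c\<in>charts_at A x. \<forall>d\<in>charts_at A x. \<forall>v.
            \<alpha> c \<bullet> v = \<alpha> d \<bullet> frechet_derivative (transition c d) (at (snd c x)) v) \<and>
          (\<forall>c. c \<notin> charts_at A x \<longrightarrow> \<alpha> c = 0)}"

definition loc :: "('a, 'e) field \<Rightarrow> ('a, 'e) chart \<Rightarrow> 'e \<Rightarrow> 'e" where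
  "loc s c y = s (chart_inv c y) c"

definition restr :: "('a, 'e) chart set \<Rightarrow> 'a set \<Rightarrow> ('a, 'e::zero) field \<Rightarrow> ('a, 'e) field" where
  "restr A U s = (\<lambda>x c. if x \<in> U \<and> c \<in> charts_at A x then s x c else 0)"

text \<open>1-forms on the open subset \<open>U\<close>, extended by 0.\<close>

definition one_forms :: "('a, 'e::real_inner) chart set \<Rightarrow> 'a set \<Rightarrow> ('a, 'e) field set" where
  "one_forms A U =
     {\<theta>. (\<forall>x\<in>U. \<theta> x \<in> cotangent_space A x) \<and> (\<forall>x. x \<notin> U \<longrightarrow> \<theta> x = (\<lambda>_. 0)) \<and>
         (\<forall>c\<in>A. smooth_on (snd c ` (fst c \<inter> U)) (loc \<theta> c))}"

definition d_fun :: "('a, 'e::real_inner) chart set \<Rightarrow> 'a set \<Rightarrow> ('a \<Rightarrow> real) \<Rightarrow> ('a, 'e) field" where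
  "d_fun A U f = restr A U (\<lambda>x c.
     adjoint (frechet_derivative (f \<circ> chart_inv c) (at (snd c x))) 1)"

text \<open>\<open>(\<L>\<^sub>X \<theta>)\<^sub>j = X\<^sup>i \<partial>\<^sub>i \<theta>\<^sub>j + \<theta>\<^sub>i \<partial>\<^sub>j X\<^sup>i\<close>\<close>

definition lie_deriv ::
  "('a, 'e::real_inner) chart set \<Rightarrow> 'a set \<Rightarrow> ('a, 'e) field \<Rightarrow> ('a, 'e) field \<Rightarrow> ('a, 'e) field" where
  "lie_deriv A U X \<theta> = restr A U (\<lambda>x c.
     frechet_derivative (loc \<theta> c) (at (snd c x)) (X x c) +
     adjoint (frechet_derivative (loc X c) (at (snd c x))) (\<theta> x c))"

text \<open>\<open>f\<^sup>*\<theta>\<close> for a smooth map \<open>f\<close> on \<open>U\<close>; as \<open>\<theta>\<close> is a 1-form the chosen chart \<open>d\<close> is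
  irrelevant.\<close>

definition pullback ::
  "('a, 'e::real_inner) chart set \<Rightarrow> 'a set \<Rightarrow> ('b, 'f::real_inner) chart set \<Rightarrow> ('a \<Rightarrow> 'b) \<Rightarrow>
   ('b, 'f) field \<Rightarrow> ('a, 'e) field" where
  "pullback A U B f \<theta> = restr A U (\<lambda>x c.
     let d = (SOME d. d \<in> charts_at B (f x))
     in adjoint (frechet_derivative (snd d \<circ> f \<circ> chart_inv c) (at (snd c x))) (\<theta> (f x) d))"


section \<open>The cotangent bundle and the bracket of 1-forms\<close>

type_synonym ('a, 'e) cot = "'a \<times> ('a, 'e) vec"

text \<open>The canonical coordinates \<open>(q, p)\<close> induced by a chart \<open>c\<close> of the base.\<close>

definition cot_chart ::
  "('a, 'e::real_inner) chart set \<Rightarrow> ('a, 'e) chart \<Rightarrow> (('a, 'e) cot, 'e \<times> 'e) chart" where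
  "cot_chart A c =
     ({z. fst z \<in> fst c \<and> snd z \<in> cotangent_space A (fst z)}, \<lambda>z. (snd c (fst z), snd z c))"

definition cot_atlas ::
  "('a, 'e::real_inner) chart set \<Rightarrow> (('a, 'e) cot, 'e \<times> 'e) chart set" where
  "cot_atlas A = cot_chart A ` A"

text \<open>The normal bundle of the zero section of \<open>T\<^sup>*M\<close> is \<open>T\<^sup>*M\<close> itself, so a tubular
  neighborhood is an open set diffeomorphic to \<open>T\<^sup>*M\<close> relative to the zero section.\<close>

definition tubular_nbhd :: "('a, 'e::real_inner) chart set \<Rightarrow> ('a, 'e) cot set \<Rightarrow> bool" where
  "tubular_nbhd A G \<longleftrightarrow> atlas_open (cot_atlas A) G \<and>
     (\<exists>\<Phi> \<Psi>. smooth_map (cot_atlas A) (pts (cot_atlas A)) (cot_atlas A) G \<Phi> \<and>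
            smooth_map (cot_atlas A) G (cot_atlas A) (pts (cot_atlas A)) \<Psi> \<and>
            (\<forall>z\<in>pts (cot_atlas A). \<Psi> (\<Phi> z) = z) \<and> (\<forall>z\<in>G. \<Phi> (\<Psi> z) = z) \<and>
            (\<forall>x\<in>pts A. \<Phi> (x, \<lambda>_. 0) = (x, \<lambda>_. 0)))"

text \<open>\<open>\<omega> = \<Sum>\<^sub>i dp\<^sub>i \<and> dq\<^sup>i\<close> in any canonical chart.\<close>

definition symp :: "'e::real_inner \<times> 'e \<Rightarrow> 'e \<times> 'e \<Rightarrow> real" where
  "symp u w = snd u \<bullet> fst w - snd w \<bullet> fst u"

definition omega ::
  "('a, 'e::real_inner) chart set \<Rightarrow> (('a, 'e) cot, 'e \<times> 'e) field \<Rightarrow>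
   (('a, 'e) cot, 'e \<times> 'e) field \<Rightarrow> ('a, 'e) cot \<Rightarrow> real" where
  "omega A X Y z = (let c = (SOME c. c \<in> charts_at (cot_atlas A) z) in symp (X z c) (Y z c))"

text \<open>The vector field \<open>X\<^sub>\<zeta>\<close> on \<open>G\<close> with \<open>\<iota>\<^bsub>X\<^sub>\<zeta>\<^esub> \<omega> = -\<zeta>\<close>.\<close>

definition ham_field ::
  "('a, 'e::real_inner) chart set \<Rightarrow> ('a, 'e) cot set \<Rightarrow> (('a, 'e) cot, 'e \<times> 'e) field \<Rightarrow>
   (('a, 'e) cot, 'e \<times> 'e) field" where
  "ham_field A G \<zeta> = restr (cot_atlas A) G (\<lambda>z c. THE u. \<forall>w. symp u w = - (\<zeta> z c \<bullet> w))"

lemma symp_sharp: "(THE u. \<forall>w. symp u w = - ((a, b) \<bullet> w)) = (b, - a)"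
proof (rule the_equality)
  show "\<forall>w. symp (b, - a) w = - ((a, b) \<bullet> w)"
    by (auto simp: symp_def inner_commute)
next
  fix u assume u: "\<forall>w. symp u w = - ((a, b) \<bullet> w)"
  have "(snd u + a) \<bullet> v = 0" for v
    using u[rule_format, of "(v, 0)"] by (simp add: symp_def inner_add_left)
  then have 1: "snd u + a = 0" by (metis inner_eq_zero_iff)
  have "(fst u - b) \<bullet> v = 0" for v
    using u[rule_format, of "(0, v)"] by 
      (simp add: symp_def inner_diff_left inner_diff_right inner_commute)
  then have 2: "fst u - b = 0" by (metis inner_eq_zero_iff)
  show "u = (b, - a)" using 1 2 by (simp add: prod_eq_iff eq_neg_iff_add_eq_0)
qed

definition bracket ::
  "('a, 'e::real_inner) chart set \<Rightarrow> ('a, 'e) cot set \<Rightarrow> (('a, 'e) cot, 'e \<times> 'e) field \<Rightarrow>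
   (('a, 'e) cot, 'e \<times> 'e) field \<Rightarrow> (('a, 'e) cot, 'e \<times> 'e) field" where
  "bracket A G \<zeta>\<^sub>1 \<zeta>\<^sub>2 =
     lie_deriv (cot_atlas A) G (ham_field A G \<zeta>\<^sub>1) \<zeta>\<^sub>2
     - lie_deriv (cot_atlas A) G (ham_field A G \<zeta>\<^sub>2) \<zeta>\<^sub>1
     - d_fun (cot_atlas A) G (omega A (ham_field A G \<zeta>\<^sub>1) (ham_field A G \<zeta>\<^sub>2))"


section \<open>The space \<open>J\<^sub>\<xi>\<^sup>\<infinity>\<close>\<close>

definition graph_forms ::
  "('a, 'e::real_inner) chart set \<Rightarrow> ('a, 'e) cot set \<Rightarrow> ('a, 'e) field set" where
  "graph_forms A G = {\<zeta> \<in> one_forms A (pts A). \<forall>x\<in>pts A. (x, \<zeta> x) \<in> G}"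

type_synonym ('a, 'e) fmap = "('a, 'e) field \<Rightarrow> ('a, 'e) field"

text \<open>Maps are extended by 0 off \<open>graph_forms A G\<close>; the vector space operations on them are the
  pointwise ones.\<close>

definition form_maps ::
  "('a, 'e::real_inner) chart set \<Rightarrow> ('a, 'e) cot set \<Rightarrow> ('a, 'e) fmap set" where
  "form_maps A G = {f. (\<forall>\<zeta>\<in>graph_forms A G. f \<zeta> \<in> one_forms A (pts A)) \<and>
                       (\<forall>\<zeta>. \<zeta> \<notin> graph_forms A G \<longrightarrow> f \<zeta> = 0)}"

definition fscale :: "real \<Rightarrow> ('a, 'e::real_vector) fmap \<Rightarrow> ('a, 'e) fmap" where
  "fscale r f = (\<lambda>\<zeta> x c. r *\<^sub>R f \<zeta> x c)"

interpretation fmap: module "fscale :: real \<Rightarrow> ('a, 'e::real_vector) fmap \<Rightarrow> ('a, 'e) fmap"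
  by unfold_locales (auto simp: fscale_def fun_eq_iff algebra_simps)

definition section_pullback ::
  "('a, 'e::real_inner) chart set \<Rightarrow> ('a, 'e) field \<Rightarrow> (('a, 'e) cot, 'e \<times> 'e) field \<Rightarrow>
   ('a, 'e) field" where
  "section_pullback A \<zeta> = pullback A (pts A) (cot_atlas A) (\<lambda>x. (x, \<zeta> x))"

definition pi_pullback ::
  "('a, 'e::real_inner) chart set \<Rightarrow> ('a, 'e) cot set \<Rightarrow> ('a, 'e) field \<Rightarrow>
   (('a, 'e) cot, 'e \<times> 'e) field" where
  "pi_pullback A G = pullback (cot_atlas A) G A fst"

definition xi_map ::
  "('a, 'e::real_inner) chart set \<Rightarrow> ('a, 'e) cot set \<Rightarrow> (('a, 'e) cot, 'e \<times> 'e) field \<Rightarrow>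
   ('a, 'e) fmap" where
  "xi_map A G \<xi> = (\<lambda>\<zeta>. if \<zeta> \<in> graph_forms A G then section_pullback A \<zeta> \<xi> else 0)"

text \<open>\<open>eta A G \<xi> [f\<^sub>1, \<dots>, f\<^sub>k]\<close> is \<open>\<eta>\<^sub>k(f\<^sub>1, \<dots>, f\<^sub>k)\<close>; the innermost bracket is the one
  with \<open>f\<^sub>k\<close>.\<close>

definition eta ::
  "('a, 'e::real_inner) chart set \<Rightarrow> ('a, 'e) cot set \<Rightarrow> (('a, 'e) cot, 'e \<times> 'e) field \<Rightarrow>
   ('a, 'e) fmap list \<Rightarrow> ('a, 'e) fmap" where
  "eta A G \<xi> fs = (\<lambda>\<zeta>. if \<zeta> \<in> graph_forms A G
     then section_pullback A \<zeta> (foldr (\<lambda>f \<theta>. bracket A G \<theta> (pi_pullback A G (f \<zeta>))) fs \<xi>)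
     else 0)"

definition J_space ::
  "('a, 'e::real_inner) chart set \<Rightarrow> ('a, 'e) cot set \<Rightarrow> (('a, 'e) cot, 'e \<times> 'e) field \<Rightarrow>
   ('a, 'e) fmap set" where
  "J_space A G \<xi> = \<Inter> {V. V \<subseteq> form_maps A G \<and> fmap.subspace V \<and> xi_map A G \<xi> \<in> V \<and>
     (\<forall>fs. fs \<noteq> [] \<and> set fs \<subseteq> V \<longrightarrow> eta A G \<xi> fs \<in> V)}"


section \<open>The product and pre-Lie algebras\<close>

definition bilinear_product_on ::
  "('a, 'e::real_vector) fmap set \<Rightarrow>
   (('a, 'e) fmap \<Rightarrow> ('a, 'e) fmap \<Rightarrow> ('a, 'e) fmap) \<Rightarrow> bool" where
  "bilinear_product_on V p \<longleftrightarrow>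
     (\<forall>f\<in>V. \<forall>g\<in>V. p f g \<in> V) \<and>
     (\<forall>f\<in>V. \<forall>g\<in>V. \<forall>h\<in>V. p (f + g) h = p f h + p g h \<and> p h (f + g) = p h f + p h g) \<and>
     (\<forall>r. \<forall>f\<in>V. \<forall>g\<in>V. p (fscale r f) g = fscale r (p f g) \<and> p f (fscale r g) = fscale r (p f g))"

text \<open>As \<open>J_space\<close> is spanned by \<open>\<xi>\<close> and the values of the \<open>\<eta>\<^sub>k\<close>, these conditions determine
  the product on \<open>J_space\<close>.\<close>

definition is_triangle_product ::
  "('a, 'e::real_inner) chart set \<Rightarrow> ('a, 'e) cot set \<Rightarrow> (('a, 'e) cot, 'e \<times> 'e) field \<Rightarrow>
   (('a, 'e) fmap \<Rightarrow> ('a, 'e) fmap \<Rightarrow> ('a, 'e) fmap) \<Rightarrow> bool" where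
  "is_triangle_product A G \<xi> p \<longleftrightarrow>
     bilinear_product_on (J_space A G \<xi>) p \<and>
     (\<forall>h\<in>J_space A G \<xi>. p h (xi_map A G \<xi>) = eta A G \<xi> [h]) \<and>
     (\<forall>h\<in>J_space A G \<xi>. \<forall>fs. fs \<noteq> [] \<and> set fs \<subseteq> J_space A G \<xi> \<longrightarrow>
        p h (eta A G \<xi> fs) =
          (\<Sum>i<length fs. eta A G \<xi> (fs[i := p h (fs ! i)])) + eta A G \<xi> (h # fs))"

definition pre_lie_algebra ::
  "('a, 'e::real_vector) fmap set \<Rightarrow>
   (('a, 'e) fmap \<Rightarrow> ('a, 'e) fmap \<Rightarrow> ('a, 'e) fmap) \<Rightarrow> bool" where
  "pre_lie_algebra V p \<longleftrightarrow> fmap.subspace V \<and> bilinear_product_on V p \<and>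
     (\<forall>f\<in>V. \<forall>g\<in>V. \<forall>h\<in>V. p (p f g) h - p f (p g h) = p (p g f) h - p g (p f h))"

end

theory Submission
  imports Defs
begin

text \<open>The pre-Lie identity is a formal consequence of one symmetry: \<open>\<eta>\<^bsub>k+2\<^esub>(f, g, f\<^sub>1, \<dots>, f\<^sub>k)\<close> does not change
  when \<open>f\<close> and \<open>g\<close> are exchanged.  Indeed the defining relations of the product say that the associator
  of \<open>f\<close>, \<open>g\<close> and \<open>\<xi>\<close> is \<open>-\<eta>\<^sub>2(f, g)\<close>, and that the associator of \<open>f\<close>, \<open>g\<close> and \<open>\<eta>\<^sub>k(f\<^sub>1, \<dots>, f\<^sub>k)\<close> is, up to
  terms symmetric in \<open>f\<close> and \<open>g\<close>, the sum of \<open>-\<eta>\<^bsub>k+2\<^esub>(f, g, f\<^sub>1, \<dots>, f\<^sub>k)\<close> and of the \<open>\<eta>\<^sub>k\<close> with the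
  associator of \<open>f\<close>, \<open>g\<close> and \<open>f\<^sub>i\<close> in the slot \<open>i\<close>.  An induction over the generation of \<open>J_space\<close> from
  \<open>\<xi>\<close> does the rest (\<open>triangle_pre_Lie\<close>).

  The symmetry (\<open>eta_swap\<close>) holds because \<open>[[\<theta>, \<pi>\<^sup>*\<alpha>], \<pi>\<^sup>*\<beta>] = [[\<theta>, \<pi>\<^sup>*\<beta>], \<pi>\<^sup>*\<alpha>]\<close>: by the Jacobi identity the
  difference is \<open>[\<theta>, [\<pi>\<^sup>*\<alpha>, \<pi>\<^sup>*\<beta>]]\<close>, and \<open>\<pi>\<^sup>*\<alpha>\<close> and \<open>\<pi>\<^sup>*\<beta>\<close> commute.  Only brackets with pullbacks from the
  base occur, and for these there is a short coordinate formula, which gives the symmetry directly.  If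
  \<open>\<theta> = a dq + b dp\<close> in canonical coordinates, then (\<open>bracket_pi_pullback_chart\<close>)

  \<open>[\<theta>, \<pi>\<^sup>*\<alpha>] = (D\<^sub>pa \<cdot> \<alpha> + D\<alpha> \<cdot> b) dq + (D\<^sub>pb \<cdot> \<alpha>) dp\<close>,

  the derivative of \<open>\<theta>\<close> along the vertical lift of \<open>\<alpha>\<close> with a correction in the base component.  A second
  bracket with \<open>\<pi>\<^sup>*\<beta>\<close> yields \<open>(D\<^sub>p\<^sup>2a(\<alpha>, \<beta>) + D\<alpha> \<cdot> D\<^sub>pb \<cdot> \<beta> + D\<beta> \<cdot> D\<^sub>pb \<cdot> \<alpha>) dq + D\<^sub>p\<^sup>2b(\<alpha>, \<beta>) dp\<close>, which is symmetric
  because second derivatives are (\<open>coord_bracket_commute\<close>).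

  What remains is to see that these formulas define objects on the manifold: the bracket of a 1-form on
  \<open>G\<close> with \<open>\<pi>\<^sup>*\<alpha>\<close> is again a 1-form (\<open>coord_bracket_law\<close>, \<open>pi_bracket_form\<close>), and its pullback along a section is
  a 1-form on the base (\<open>section_pullback_form\<close>).  This is needed twice: the iterated brackets evaluate
  \<open>\<omega>\<close> in arbitrarily chosen charts, and the maps with values in 1-forms must be closed under all \<open>\<eta>\<^sub>k\<close> for
  \<open>J_space\<close> to consist of such maps.\<close>

section \<open>Differential calculus in finite dimension\<close>

abbreviation Dv :: "('e::real_normed_vector \<Rightarrow> 'f::real_normed_vector) \<Rightarrow> 'e \<Rightarrow> 'e \<Rightarrow> 'f" where
  "Dv f y \<equiv> frechet_derivative f (at y)"

lemma Dv_eq: "(f has_derivative f') (at y) \<Longrightarrow> Dv f y = f'"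
  by (rule frechet_derivative_at[symmetric])

lemma Dv_works: "f differentiable at y \<Longrightarrow> (f has_derivative Dv f y) (at y)"
  by (simp add: frechet_derivative_works)

lemma Dv_cong:
  assumes "open S" "y \<in> S" "\<And>x. x \<in> S \<Longrightarrow> f x = g x"
  shows "Dv f y = Dv g y"
proof -
  have "(f has_derivative f') (at y) \<longleftrightarrow> (g has_derivative f') (at y)" for f'
    using has_derivative_transform_within_open[of f f' y UNIV S g]
      has_derivative_transform_within_open[of g f' y UNIV S f] assms by auto
  then show ?thesis by (simp add: frechet_derivative_def)
qed

lemma differentiable_cong_open:
  assumes "open S" "y \<in> S" "\<And>x. x \<in> S \<Longrightarrow> f x = g x" "f differentiable at y"
  shows "g differentiable at y"
  using assms has_derivative_transform_within_open[of f _ y UNIV S g]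
  unfolding differentiable_def by auto

lemma Ck_on_cong:
  assumes "open S" "\<And>x. x \<in> S \<Longrightarrow> f x = g x" "Ck_on k S f"
  shows "Ck_on k S g"
  using assms(2,3)
proof (induction k arbitrary: f g)
  case 0
  then show ?case by (auto cong: continuous_on_cong)
next
  case (Suc k)
  have "Dv f y = Dv g y" if "y \<in> S" for y
    using Dv_cong[OF assms(1) that] Suc.prems by blast
  then have "Ck_on k S (\<lambda>y. Dv g y v)" for v
    using Suc.IH[of "\<lambda>y. Dv f y v" "\<lambda>y. Dv g y v"] Suc.prems by auto
  then show ?case
    using differentiable_cong_open[OF assms(1) _ Suc.prems(1)] Suc.prems(2) by auto
qed

lemma Ck_on_SucD: "Ck_on (Suc k) S f \<Longrightarrow> Ck_on k S f"
proof (induction k arbitrary: f)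
  case 0
  then show ?case
    by (auto intro!: continuous_at_imp_continuous_on differentiable_imp_continuous_within)
next
  case (Suc k)
  from Suc.prems have "f differentiable at y" if "y \<in> S" for y
    using that by auto
  moreover have "Ck_on (Suc k) S (\<lambda>y. Dv f y v)" for v
    using Suc.prems by (simp only: Ck_on.simps) blast
  ultimately show ?case using Suc.IH by auto
qed

lemma Ck_on_subset: "Ck_on k S f \<Longrightarrow> T \<subseteq> S \<Longrightarrow> Ck_on k T f"
  by (induction k arbitrary: f) (auto intro: continuous_on_subset)

lemma Ck_on_SucI:
  assumes "open S" "\<And>y. y \<in> S \<Longrightarrow> (f has_derivative f' y) (at y)"
    and "\<And>v. Ck_on k S (\<lambda>y. f' y v)"
  shows "Ck_on (Suc k) S f"
proof -
  have "Ck_on k S (\<lambda>y. Dv f y v)" for v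
    by (rule Ck_on_cong[OF assms(1) _ assms(3)[of v]]) (simp add: Dv_eq[OF assms(2)])
  then show ?thesis using assms(2) by (auto simp: differentiable_def)
qed

lemma Ck_on_has_derivative:
  "Ck_on (Suc k) S f \<Longrightarrow> y \<in> S \<Longrightarrow> (f has_derivative Dv f y) (at y)"
  by (simp add: Dv_works)

lemma Ck_on_Dv: "Ck_on (Suc k) S f \<Longrightarrow> Ck_on k S (\<lambda>y. Dv f y v)"
  by simp

lemma Ck_on_const: "Ck_on k S (\<lambda>_. c)"
  by (induction k arbitrary: c) auto

lemma Ck_on_bounded_linear:
  assumes "open S" "bounded_linear h"
  shows "Ck_on k S h"
proof (cases k)
  case 0
  then show ?thesis by (simp add: assms linear_continuous_on)
next
  case (Suc k')
  then show ?thesis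
    using Ck_on_SucI[OF assms(1), of h "\<lambda>_. h" k'] assms(2)
    by (simp add: bounded_linear_imp_has_derivative Ck_on_const)
qed

lemma Ck_on_bounded_linear_compose:
  assumes "open S" "bounded_linear h" "Ck_on k S f"
  shows "Ck_on k S (\<lambda>y. h (f y))"
  using assms(3)
proof (induction k arbitrary: f)
  case 0
  then show ?case
    by (auto intro!: continuous_on_compose2[OF linear_continuous_on[OF assms(2), of UNIV]])
next
  case (Suc k)
  show ?case
    by (rule Ck_on_SucI[OF assms(1), where f' = "\<lambda>y v. h (Dv f y v)"])
      (use Suc in \<open>auto intro!: bounded_linear.has_derivative[OF assms(2)] Dv_works\<close>)
qed

lemma Ck_on_add:
  assumes "open S" "Ck_on k S f" "Ck_on k S g"
  shows "Ck_on k S (\<lambda>y. f y + g y)"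
  using assms(2,3)
proof (induction k arbitrary: f g)
  case 0
  then show ?case by (auto intro: continuous_on_add)
next
  case (Suc k)
  show ?case
    by (rule Ck_on_SucI[OF assms(1), where f' = "\<lambda>y v. Dv f y v + Dv g y v"])
      (use Suc in \<open>auto intro!: has_derivative_add Dv_works\<close>)
qed

lemma Ck_on_sum:
  assumes "open S" "\<And>i. i \<in> I \<Longrightarrow> Ck_on k S (f i)"
  shows "Ck_on k S (\<lambda>y. \<Sum>i\<in>I. f i y)"
  using assms(2)
  by (induction I rule: infinite_finite_induct) (auto intro: Ck_on_const Ck_on_add[OF assms(1)])

text \<open>By the product rule the directional derivative is a sum of two expressions of the same shape, so
  the induction has to run over all pairs of functions at once.\<close>

lemma Ck_on_bilinear:
  assumes "open S" "bounded_bilinear b" "Ck_on k S f" "Ck_on k S g"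
  shows "Ck_on k S (\<lambda>y. b (f y) (g y))"
  using assms(3,4)
proof (induction k arbitrary: f g)
  case 0
  then show ?case by (auto intro: bounded_bilinear.continuous_on[OF assms(2)])
next
  case (Suc k)
  show ?case
  proof (rule Ck_on_SucI[OF assms(1), where f' = "\<lambda>y v. b (f y) (Dv g y v) + b (Dv f y v) (g y)"])
    fix v
    show "Ck_on k S (\<lambda>y. b (f y) (Dv g y v) + b (Dv f y v) (g y))"
      using Suc by (intro Ck_on_add[OF assms(1)]) (auto dest: Ck_on_SucD simp del: Ck_on.simps intro: Ck_on_Dv)
  qed (use Suc.prems in \<open>auto intro!: bounded_bilinear.FDERIV[OF assms(2)] Dv_works\<close>)
qed

text \<open>A finite Parseval frame.  Unlike a basis it may contain 0 and repeated directions up to scaling, so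
  frames of the factors give a frame of a product without any side condition; and in dimension 0 the
  empty set is one.  It is the only trace of finite dimension in what follows: linear maps have
  adjoints, and the value of a linear map at a varying vector is a finite sum of its values at fixed
  vectors.\<close>

definition frame :: "'e::real_inner set \<Rightarrow> bool" where
  "frame E \<longleftrightarrow> finite E \<and> (\<forall>x. (\<Sum>e\<in>E. (x \<bullet> e) *\<^sub>R e) = x)"

lemma frame_expand: "frame E \<Longrightarrow> x = (\<Sum>e\<in>E. (x \<bullet> e) *\<^sub>R e)"
  by (simp add: frame_def)

text \<open>Orthogonalise a spanning set, discard 0 and normalise.\<close>

lemma frame_exists:
  assumes "finite B" "span B = (UNIV :: 'e::real_inner set)"
  shows "\<exists>E :: 'e set. frame E"
proof -
  obtain C where C: "finite C" "span C = (UNIV :: 'e set)" "pairwise orthogonal C"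
    using basis_orthogonal[OF assms(1)] assms(2) by metis
  define E where "E = (\<lambda>c. c /\<^sub>R norm c) ` (C - {0})"
  have fin: "finite E" using C by (simp add: E_def)
  have on: "e \<bullet> e' = (if e = e' then 1 else 0)" if "e \<in> E" "e' \<in> E" for e e'
  proof -
    from that obtain c c' where c: "c \<in> C" "c \<noteq> 0" "e = c /\<^sub>R norm c" "c' \<in> C" "c' \<noteq> 0" "e' = c' /\<^sub>R norm c'"
      unfolding E_def by blast
    show ?thesis
    proof (cases "c = c'")
      case True
      then show ?thesis using c by (simp add: dot_square_norm power2_eq_square)
    next
      case False
      then have 0: "e \<bullet> e' = 0" using C(3) c by (auto simp: pairwise_def orthogonal_def)
      moreover have "e \<bullet> e \<noteq> 0" using c by simp
      then have "e \<noteq> e'" using 0 by auto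
      ultimately show ?thesis by simp
    qed
  qed
  have "span E = UNIV"
  proof -
    have "c \<in> span E" if "c \<in> C" for c
    proof (cases "c = 0")
      case False
      then have "norm c *\<^sub>R (c /\<^sub>R norm c) \<in> span E"
        using that by (intro span_scale span_base) (auto simp: E_def)
      then show ?thesis using False by simp
    qed (simp add: span_zero)
    then have "span C \<subseteq> span E" by (intro span_minimal) auto
    then show ?thesis using C(2) by auto
  qed
  have "(\<Sum>e\<in>E. (x \<bullet> e) *\<^sub>R e) = x" for x
  proof -
    obtain u where u: "x = (\<Sum>v\<in>E. u v *\<^sub>R v)"
      using \<open>span E = UNIV\<close> span_finite[OF fin] by blast
    have "x \<bullet> e = u e" if "e \<in> E" for e
    proof -
      have "x \<bullet> e = (\<Sum>v\<in>E. u v * (if v = e then 1 else 0))"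
        unfolding u inner_sum_left using on that by (intro sum.cong) auto
      also have "\<dots> = u e" using that fin by (simp add: if_distrib[of "\<lambda>r. _ * r"] cong: if_cong)
      finally show ?thesis .
    qed
    then show ?thesis using u by simp
  qed
  then show ?thesis using fin by (auto simp: frame_def)
qed

lemma frame_prod:
  assumes "frame E" "frame F"
  shows "frame ((\<lambda>e. (e, 0)) ` E \<union> (\<lambda>e. (0, e)) ` F)"
proof -
  have fin: "finite E" "finite F" using assms by (auto simp: frame_def)
  have "(\<Sum>e\<in>(\<lambda>e. (e, 0)) ` E \<union> (\<lambda>e. (0, e)) ` F. (x \<bullet> e) *\<^sub>R e) = x" for x :: "'a \<times> 'b"
  proof -
    have "(\<Sum>e\<in>(\<lambda>e. (e, 0)) ` E \<union> (\<lambda>e. (0, e)) ` F. (x \<bullet> e) *\<^sub>R e)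
       = (\<Sum>e\<in>(\<lambda>e. (e, 0)) ` E. (x \<bullet> e) *\<^sub>R e) + (\<Sum>e\<in>(\<lambda>e. (0, e)) ` F. (x \<bullet> e) *\<^sub>R e)"
      using fin by (intro sum.union_inter_neutral) (auto simp: zero_prod_def[symmetric])
    also have "\<dots> = (\<Sum>e\<in>E. ((fst x \<bullet> e) *\<^sub>R e, 0)) + (\<Sum>e\<in>F. (0, (snd x \<bullet> e) *\<^sub>R e))"
      by (subst (1 2) sum.reindex) (auto simp: inj_on_def inner_prod_def)
    also have "\<dots> = (\<Sum>e\<in>E. (fst x \<bullet> e) *\<^sub>R e, \<Sum>e\<in>F. (snd x \<bullet> e) *\<^sub>R e)"
      by (simp add: prod_eq_iff fst_sum snd_sum)
    finally show ?thesis using assms by (simp add: frame_def)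
  qed
  then show ?thesis using fin by (auto simp: frame_def)
qed

lemma linear_frame:
  assumes "frame E" "linear f"
  shows "f x = (\<Sum>e\<in>E. (x \<bullet> e) *\<^sub>R f e)"
proof -
  have "f x = f (\<Sum>e\<in>E. (x \<bullet> e) *\<^sub>R e)" using frame_expand[OF assms(1), of x] by simp
  then show ?thesis by (simp add: linear_sum[OF assms(2)] linear_scale[OF assms(2)])
qed

lemma adjoint_inner:
  fixes f :: "'a::real_inner \<Rightarrow> 'b::real_inner" and E :: "'a set"
  assumes "frame E" "linear f"
  shows "adjoint f y \<bullet> x = y \<bullet> f x" and "x \<bullet> adjoint f y = y \<bullet> f x"
proof -
  define g where "g y = (\<Sum>e\<in>E. (f e \<bullet> y) *\<^sub>R e)" for y
  have g: "f x \<bullet> y = x \<bullet> g y" for x y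
    unfolding g_def by (subst linear_frame[OF assms]) (simp add: inner_sum_left inner_sum_right mult.commute)
  then have "adjoint f = g" by (intro adjoint_unique allI)
  then have "f x \<bullet> y = x \<bullet> adjoint f y" by (simp add: g)
  then show "adjoint f y \<bullet> x = y \<bullet> f x" "x \<bullet> adjoint f y = y \<bullet> f x"
    by (simp_all add: inner_commute)
qed

lemma adjoint_frame:
  assumes "frame E" "linear f"
  shows "adjoint f y = (\<Sum>e\<in>E. (y \<bullet> f e) *\<^sub>R e)"
  using frame_expand[OF assms(1), of "adjoint f y"] unfolding adjoint_inner(1)[OF assms] .

text \<open>In the chain rule the argument of \<open>Dv f (g y)\<close> varies with \<open>y\<close>, whereas \<open>Ck_on\<close> speaks of
  derivatives in fixed directions only.  Expanding the argument in a frame reduces the former to the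
  latter.\<close>

lemma Ck_on_compose:
  fixes f :: "'b::real_inner \<Rightarrow> 'c::real_normed_vector" and E :: "'b set"
  assumes "frame E" "open S" "open T" "g ` S \<subseteq> T" "Ck_on k S g" "Ck_on k T f"
  shows "Ck_on k S (\<lambda>y. f (g y))"
  using assms(5,6)
proof (induction k arbitrary: f)
  case 0
  then show ?case using assms(4) by (auto intro: continuous_on_compose2)
next
  case (Suc k)
  have lin: "linear (Dv f (g y))" if "y \<in> S" for y
    using Suc.prems(2) that assms(4) by (intro linear_frechet_derivative) auto
  show ?case
  proof (rule Ck_on_SucI[OF assms(2), where f' = "\<lambda>y v. Dv f (g y) (Dv g y v)"])
    fix y assume "y \<in> S"
    then show "((\<lambda>y. f (g y)) has_derivative (\<lambda>v. Dv f (g y) (Dv g y v))) (at y)"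
      using assms(4) by (intro has_derivative_compose[OF Ck_on_has_derivative[OF Suc.prems(1)]
            Ck_on_has_derivative[OF Suc.prems(2)]]) auto
  next
    fix v
    have g: "Ck_on k S g" using Suc.prems(1) by (rule Ck_on_SucD)
    have "Ck_on k S (\<lambda>y. (Dv g y v \<bullet> e) *\<^sub>R Dv f (g y) e)" for e
    proof (rule Ck_on_bilinear[OF assms(2) bounded_bilinear_scaleR])
      show "Ck_on k S (\<lambda>y. Dv g y v \<bullet> e)"
        by (rule Ck_on_bounded_linear_compose[OF assms(2) bounded_linear_inner_left])
          (rule Ck_on_Dv[OF Suc.prems(1)])
      show "Ck_on k S (\<lambda>y. Dv f (g y) e)"
        by (rule Suc.IH[OF g]) (rule Ck_on_Dv[OF Suc.prems(2)])
    qed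
    then have "Ck_on k S (\<lambda>y. \<Sum>e\<in>E. (Dv g y v \<bullet> e) *\<^sub>R Dv f (g y) e)"
      by (rule Ck_on_sum[OF assms(2)])
    then show "Ck_on k S (\<lambda>y. Dv f (g y) (Dv g y v))"
      by (rule Ck_on_cong[OF assms(2), rotated]) (rule linear_frame[OF assms(1) lin, symmetric])
  qed
qed

text \<open>The mean value theorem in the direction \<open>u\<close>, applied to the increment in the direction \<open>v\<close>, and then
  once more in the direction \<open>v\<close>.\<close>

lemma second_difference_mvt:
  fixes \<phi> :: "'e::real_normed_vector \<Rightarrow> real"
  assumes "h > 0"
    and in_S: "\<And>s t. 0 \<le> s \<Longrightarrow> s \<le> h \<Longrightarrow> 0 \<le> t \<Longrightarrow> t \<le> h \<Longrightarrow> x + s *\<^sub>R u + t *\<^sub>R v \<in> S"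
    and d1: "\<And>y. y \<in> S \<Longrightarrow> \<phi> differentiable at y"
    and d2: "\<And>y. y \<in> S \<Longrightarrow> (\<lambda>y. Dv \<phi> y u) differentiable at y"
  obtains s t where "0 \<le> s" "s \<le> h" "0 \<le> t" "t \<le> h"
    "\<phi> (x + h *\<^sub>R u + h *\<^sub>R v) - \<phi> (x + h *\<^sub>R u) - \<phi> (x + h *\<^sub>R v) + \<phi> x
       = h * h * Dv (\<lambda>y. Dv \<phi> y u) (x + s *\<^sub>R u + t *\<^sub>R v) v"
proof -
  let ?p = "\<lambda>s t. x + s *\<^sub>R u + t *\<^sub>R v"
  have du: "((\<lambda>s. \<phi> (?p s t)) has_real_derivative Dv \<phi> (?p s t) u) (at s)"
    if "0 \<le> s" "s \<le> h" "0 \<le> t" "t \<le> h" for s t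
  proof -
    note D = Dv_works[OF d1[OF in_S[OF that]]]
    have "((\<lambda>s. \<phi> (?p s t)) has_derivative (\<lambda>r. Dv \<phi> (?p s t) (r *\<^sub>R u))) (at s)"
      by (rule has_derivative_compose[where g = \<phi> and f = "\<lambda>s. ?p s t", OF _ D]) (auto intro!: derivative_eq_intros)
    then show ?thesis
      by (simp add: has_field_derivative_def linear_scale[OF has_derivative_linear[OF D]] mult.commute[of _ "Dv _ _ _"])
  qed
  have dv: "((\<lambda>t. Dv \<phi> (?p s t) u) has_real_derivative Dv (\<lambda>y. Dv \<phi> y u) (?p s t) v) (at t)"
    if "0 \<le> s" "s \<le> h" "0 \<le> t" "t \<le> h" for s t
  proof -
    note D = Dv_works[OF d2[OF in_S[OF that]]]
    have "((\<lambda>t. Dv \<phi> (?p s t) u) has_derivative (\<lambda>r. Dv (\<lambda>y. Dv \<phi> y u) (?p s t) (r *\<^sub>R v))) (at t)"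
      by (rule has_derivative_compose[where g = "\<lambda>y. Dv \<phi> y u" and f = "\<lambda>t. ?p s t", OF _ D]) (auto intro!: derivative_eq_intros)
    then show ?thesis
      by (simp add: has_field_derivative_def linear_scale[OF has_derivative_linear[OF D]] mult.commute[of _ "Dv _ _ _"])
  qed
  have "\<exists>s>0. s < h \<and> (\<phi> (?p h h) - \<phi> (?p h 0)) - (\<phi> (?p 0 h) - \<phi> (?p 0 0))
      = (h - 0) * (Dv \<phi> (?p s h) u - Dv \<phi> (?p s 0) u)"
    using \<open>h > 0\<close> by (intro MVT2[of 0 h "\<lambda>s. \<phi> (?p s h) - \<phi> (?p s 0)"] DERIV_diff du) auto
  then obtain s where s: "0 < s" "s < h"
    "(\<phi> (?p h h) - \<phi> (?p h 0)) - (\<phi> (?p 0 h) - \<phi> (?p 0 0)) = h * (Dv \<phi> (?p s h) u - Dv \<phi> (?p s 0) u)"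
    by auto
  have "\<exists>t>0. t < h \<and> Dv \<phi> (?p s h) u - Dv \<phi> (?p s 0) u = (h - 0) * Dv (\<lambda>y. Dv \<phi> y u) (?p s t) v"
    using \<open>h > 0\<close> s by (intro MVT2[of 0 h "\<lambda>t. Dv \<phi> (?p s t) u"] dv) auto
  then obtain t where t: "0 < t" "t < h"
    "Dv \<phi> (?p s h) u - Dv \<phi> (?p s 0) u = h * Dv (\<lambda>y. Dv \<phi> y u) (?p s t) v"
    by auto
  show ?thesis
    by (rule that[of s t]) (use s t in \<open>auto simp: algebra_simps\<close>)
qed

text \<open>The second difference does not change when \<open>u\<close> and \<open>v\<close> are exchanged; the mean value theorem turns it
  into either of the two mixed derivatives at points arbitrarily close to \<open>x\<close>, and these are continuous.\<close>

lemma Ck_on_symmetric_real: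
  fixes \<phi> :: "'e::real_normed_vector \<Rightarrow> real"
  assumes "open S" "Ck_on 2 S \<phi>" "x \<in> S"
  shows "Dv (\<lambda>y. Dv \<phi> y u) x v = Dv (\<lambda>y. Dv \<phi> y v) x u"
proof -
  have C: "Ck_on (Suc (Suc 0)) S \<phi>" using assms(2) by (simp add: numeral_2_eq_2)
  let ?H = "\<lambda>u v y. Dv (\<lambda>y. Dv \<phi> y u) y v"
  have cont: "continuous_on S (?H u v)" for u v using C by simp
  have small: "\<exists>\<delta>>0. \<forall>s t. 0 \<le> s \<and> s \<le> \<delta> \<and> 0 \<le> t \<and> t \<le> \<delta> \<longrightarrow>
      x + s *\<^sub>R u + t *\<^sub>R v \<in> S \<and> \<bar>?H u v (x + s *\<^sub>R u + t *\<^sub>R v) - ?H u v x\<bar> < e" if "e > 0" for e u v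
  proof -
    have "((\<lambda>y. ?H u v y) \<longlongrightarrow> ?H u v x) (nhds x)"
      using cont assms(1,3) by (metis continuous_on_eq_continuous_at isCont_def tendsto_at_iff_tendsto_nhds)
    then have "eventually (\<lambda>y. y \<in> S \<and> dist (?H u v y) (?H u v x) < e) (nhds x)"
      using that assms(1,3) by (intro eventually_conj eventually_nhds_in_open tendstoD) auto
    then obtain r where r: "r > 0" "\<And>y. dist y x < r \<Longrightarrow> y \<in> S \<and> \<bar>?H u v y - ?H u v x\<bar> < e"
      unfolding eventually_nhds_metric dist_real_def by blast
    \<comment> \<open>a parallelogram at \<open>x\<close> with sides at most \<open>\<delta> u\<close> and \<open>\<delta> v\<close> stays at distance less than \<open>r\<close>\<close>
    define \<delta> where "\<delta> = r / (2 * (norm u + norm v + 1))"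
    have pos: "\<delta> > 0" unfolding \<delta>_def using r by (auto intro!: divide_pos_pos add_nonneg_pos)
    have "dist (x + s *\<^sub>R u + t *\<^sub>R v) x < r" if "0 \<le> s" "s \<le> \<delta>" "0 \<le> t" "t \<le> \<delta>" for s t
    proof -
      have "norm (s *\<^sub>R u + t *\<^sub>R v) \<le> s * norm u + t * norm v"
        using that by (intro norm_triangle_le) auto
      also have "\<dots> \<le> \<delta> * norm u + \<delta> * norm v"
        using that by (intro add_mono mult_right_mono) auto
      also have "\<dots> \<le> \<delta> * (norm u + norm v + 1)"
        using pos by (simp add: algebra_simps)
      also have "\<dots> = r / 2" unfolding \<delta>_def using norm_ge_zero[of u] norm_ge_zero[of v]
        by (simp add: field_simps add_nonneg_eq_0_iff)
      also have "\<dots> < r" using r by simp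
      finally show ?thesis by (simp add: dist_norm add.assoc)
    qed
    then show ?thesis using pos r(2) by (intro exI[of _ \<delta>]) auto
  qed
  have "\<bar>?H u v x - ?H v u x\<bar> \<le> e" if "e > 0" for e
  proof -
    have e: "e / 2 > 0" using that by simp
    obtain \<delta>1 where 1: "\<delta>1 > 0" "\<And>s t. 0 \<le> s \<Longrightarrow> s \<le> \<delta>1 \<Longrightarrow> 0 \<le> t \<Longrightarrow> t \<le> \<delta>1 \<Longrightarrow>
      x + s *\<^sub>R u + t *\<^sub>R v \<in> S \<and> \<bar>?H u v (x + s *\<^sub>R u + t *\<^sub>R v) - ?H u v x\<bar> < e/2"
      using small[of "e/2" u v] e by blast
    obtain \<delta>2 where 2: "\<delta>2 > 0" "\<And>s t. 0 \<le> s \<Longrightarrow> s \<le> \<delta>2 \<Longrightarrow> 0 \<le> t \<Longrightarrow> t \<le> \<delta>2 \<Longrightarrow>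
      x + s *\<^sub>R v + t *\<^sub>R u \<in> S \<and> \<bar>?H v u (x + s *\<^sub>R v + t *\<^sub>R u) - ?H v u x\<bar> < e/2"
      using small[of "e/2" v u] e by blast
    define h where "h = min \<delta>1 \<delta>2"
    have h: "h > 0" "h \<le> \<delta>1" "h \<le> \<delta>2" using 1(1) 2(1) by (auto simp: h_def)
    have d: "\<phi> differentiable at y" "(\<lambda>y. Dv \<phi> y w) differentiable at y" if "y \<in> S" for y w
      using C that by auto
    obtain s t where st: "0 \<le> s" "s \<le> h" "0 \<le> t" "t \<le> h"
      "\<phi> (x + h *\<^sub>R u + h *\<^sub>R v) - \<phi> (x + h *\<^sub>R u) - \<phi> (x + h *\<^sub>R v) + \<phi> x
       = h * h * ?H u v (x + s *\<^sub>R u + t *\<^sub>R v)"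
      by (rule second_difference_mvt[of h x u v S \<phi>]) (use 1 h d in auto)
    obtain s' t' where st': "0 \<le> s'" "s' \<le> h" "0 \<le> t'" "t' \<le> h"
      "\<phi> (x + h *\<^sub>R v + h *\<^sub>R u) - \<phi> (x + h *\<^sub>R v) - \<phi> (x + h *\<^sub>R u) + \<phi> x
       = h * h * ?H v u (x + s' *\<^sub>R v + t' *\<^sub>R u)"
      by (rule second_difference_mvt[of h x v u S \<phi>]) (use 2 h d in auto)
    have "h * h * ?H u v (x + s *\<^sub>R u + t *\<^sub>R v) = h * h * ?H v u (x + s' *\<^sub>R v + t' *\<^sub>R u)"
      unfolding st(5)[symmetric] st'(5)[symmetric] by (simp add: algebra_simps)
    then have "?H u v (x + s *\<^sub>R u + t *\<^sub>R v) = ?H v u (x + s' *\<^sub>R v + t' *\<^sub>R u)"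
      using h by simp
    moreover have "\<bar>?H u v (x + s *\<^sub>R u + t *\<^sub>R v) - ?H u v x\<bar> < e/2"
      using 1(2)[of s t] st h by auto
    moreover have "\<bar>?H v u (x + s' *\<^sub>R v + t' *\<^sub>R u) - ?H v u x\<bar> < e/2"
      using 2(2)[of s' t'] st' h by auto
    ultimately show ?thesis by linarith
  qed
  then have "\<bar>?H u v x - ?H v u x\<bar> \<le> 0"
    by (rule field_le_epsilon) simp
  then show ?thesis by simp
qed

lemma Ck_on_symmetric:
  fixes f :: "'e::real_normed_vector \<Rightarrow> 'f::real_inner"
  assumes "open S" "Ck_on 2 S f" "x \<in> S"
  shows "Dv (\<lambda>y. Dv f y u) x v = Dv (\<lambda>y. Dv f y v) x u"
proof -
  have C: "Ck_on (Suc (Suc 0)) S f" using assms(2) by (simp add: numeral_2_eq_2)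
  have 1: "Dv (\<lambda>y. f y \<bullet> w) y u = Dv f y u \<bullet> w" if "y \<in> S" for w y u
    using Dv_eq[OF has_derivative_inner_left[OF Ck_on_has_derivative[OF C that]]] by simp
  have 2: "Dv (\<lambda>y. Dv (\<lambda>y. f y \<bullet> w) y u) x v = Dv (\<lambda>y. Dv f y u) x v \<bullet> w" for w u v
  proof -
    have "Dv (\<lambda>y. Dv (\<lambda>y. f y \<bullet> w) y u) x = Dv (\<lambda>y. Dv f y u \<bullet> w) x"
      by (rule Dv_cong[OF assms(1,3) 1])
    also have "\<dots> = (\<lambda>v. Dv (\<lambda>y. Dv f y u) x v \<bullet> w)"
      by (rule Dv_eq[OF has_derivative_inner_left[OF Ck_on_has_derivative[OF Ck_on_Dv[OF C] assms(3)]]])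
    finally show ?thesis by simp
  qed
  have "Dv (\<lambda>y. Dv f y u) x v \<bullet> w = Dv (\<lambda>y. Dv f y v) x u \<bullet> w" for w
    unfolding 2[symmetric]
    by (rule Ck_on_symmetric_real[OF assms(1) _ assms(3)])
      (rule Ck_on_bounded_linear_compose[OF assms(1) bounded_linear_inner_left assms(2)])
  then show ?thesis by (metis vector_eq_rdot)
qed


lemma smooth_on_cong:
  "open S \<Longrightarrow> (\<And>x. x \<in> S \<Longrightarrow> f x = g x) \<Longrightarrow> smooth_on S f \<Longrightarrow> smooth_on S g"
  unfolding smooth_on_def using Ck_on_cong by blast

lemma smooth_on_subset: "smooth_on S f \<Longrightarrow> T \<subseteq> S \<Longrightarrow> smooth_on T f"
  unfolding smooth_on_def using Ck_on_subset by blast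

lemma smooth_on_has_derivative: "smooth_on S f \<Longrightarrow> y \<in> S \<Longrightarrow> (f has_derivative Dv f y) (at y)"
  unfolding smooth_on_def using Ck_on_has_derivative by blast

lemma smooth_on_linear: "smooth_on S f \<Longrightarrow> y \<in> S \<Longrightarrow> linear (Dv f y)"
  using smooth_on_has_derivative has_derivative_linear by blast

lemma smooth_on_Dv: "smooth_on S f \<Longrightarrow> smooth_on S (\<lambda>y. Dv f y v)"
  unfolding smooth_on_def using Ck_on_Dv by blast

lemma smooth_on_bounded_linear: "open S \<Longrightarrow> bounded_linear h \<Longrightarrow> smooth_on S h"
  unfolding smooth_on_def using Ck_on_bounded_linear by blast

lemma smooth_on_bounded_linear_compose:
  "open S \<Longrightarrow> bounded_linear h \<Longrightarrow> smooth_on S f \<Longrightarrow> smooth_on S (\<lambda>y. h (f y))"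
  unfolding smooth_on_def using Ck_on_bounded_linear_compose by blast

lemma smooth_on_const: "smooth_on S (\<lambda>_. c)"
  unfolding smooth_on_def using Ck_on_const by blast

lemma smooth_on_add:
  "open S \<Longrightarrow> smooth_on S f \<Longrightarrow> smooth_on S g \<Longrightarrow> smooth_on S (\<lambda>y. f y + g y)"
  unfolding smooth_on_def using Ck_on_add by blast

lemma smooth_on_sum:
  "open S \<Longrightarrow> (\<And>i. i \<in> I \<Longrightarrow> smooth_on S (f i)) \<Longrightarrow> smooth_on S (\<lambda>y. \<Sum>i\<in>I. f i y)"
  unfolding smooth_on_def by (auto intro: Ck_on_sum)

lemma smooth_on_bilinear:
  "open S \<Longrightarrow> bounded_bilinear b \<Longrightarrow> smooth_on S f \<Longrightarrow> smooth_on S g \<Longrightarrow> smooth_on S (\<lambda>y. b (f y) (g y))"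
  unfolding smooth_on_def using Ck_on_bilinear by blast

lemma smooth_on_compose:
  fixes f :: "'b::real_inner \<Rightarrow> 'c::real_normed_vector" and E :: "'b set"
  assumes "frame E" "open S" "open T" "g ` S \<subseteq> T" "smooth_on S g" "smooth_on T f"
  shows "smooth_on S (\<lambda>y. f (g y))"
  using assms Ck_on_compose[OF assms(1-4)] unfolding smooth_on_def by blast

lemma smooth_on_Pair:
  assumes "open S" "smooth_on S f" "smooth_on S g"
  shows "smooth_on S (\<lambda>y. (f y, g y))"
proof -
  have "smooth_on S (\<lambda>y. (f y, 0) + (0, g y))"
    by (intro smooth_on_add[OF assms(1)]
        smooth_on_bounded_linear_compose[OF assms(1) _ assms(2), of "\<lambda>x. (x, 0)"]
        smooth_on_bounded_linear_compose[OF assms(1) _ assms(3), of "\<lambda>x. (0, x)"]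
        bounded_linear_Pair bounded_linear_ident bounded_linear_zero)
  then show ?thesis by simp
qed

text \<open>The form in which frames are used for smoothness: a linear map depending smoothly on \<open>y\<close>, evaluated
  at a vector depending smoothly on \<open>y\<close>.\<close>

lemma smooth_on_apply_linear:
  fixes L :: "'b::real_inner \<Rightarrow> 'e::real_normed_vector \<Rightarrow> 'c::real_normed_vector" and E :: "'b set"
  assumes "frame E" "open S" "smooth_on S g" "\<And>y. y \<in> S \<Longrightarrow> linear (\<lambda>v. L v y)"
    and "\<And>e. smooth_on S (L e)"
  shows "smooth_on S (\<lambda>y. L (g y) y)"
proof -
  have "smooth_on S (\<lambda>y. \<Sum>e\<in>E. (g y \<bullet> e) *\<^sub>R L e y)"
    by (intro smooth_on_sum[OF assms(2)] smooth_on_bilinear[OF assms(2) bounded_bilinear_scaleR]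
        smooth_on_bounded_linear_compose[OF assms(2) bounded_linear_inner_left] assms(3,5))
  then show ?thesis
    by (rule smooth_on_cong[OF assms(2), rotated]) (rule linear_frame[OF assms(1,4), symmetric])
qed

lemma smooth_on_symmetric:
  fixes f :: "'e::real_normed_vector \<Rightarrow> 'f::real_inner"
  assumes "open S" "smooth_on S f" "x \<in> S"
  shows "Dv (\<lambda>y. Dv f y u) x v = Dv (\<lambda>y. Dv f y v) x u"
  by (rule Ck_on_symmetric[OF assms(1) _ assms(3)]) (use assms(2) in \<open>simp only: smooth_on_def\<close>)

section \<open>Change of canonical coordinates and the bracket in coordinates\<close>

text \<open>A change of coordinates \<open>\<tau>\<close> of the base induces the change of canonical coordinates
  \<open>(q, p) \<mapsto> (\<tau> q, P (q, p))\<close>, where \<open>P (q, p)\<close> is the covector \<open>p\<close> in the new coordinates.  The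
  transposed inverse of \<open>Dv \<tau> q\<close> is a formula for it, but the identity \<open>dual\<close> is easier to differentiate.\<close>

locale cotangent_lift =
  fixes E :: "'e::real_inner set" and V :: "'e set" and \<tau> :: "'e \<Rightarrow> 'e" and P :: "'e \<times> 'e \<Rightarrow> 'e"
  assumes E: "frame E"
    and open_V: "open V"
    and \<tau>: "smooth_on V \<tau>"
    and P: "smooth_on (V \<times> UNIV) P"
    and dual: "\<And>q p v. q \<in> V \<Longrightarrow> P (q, p) \<bullet> Dv \<tau> q v = p \<bullet> v"
    and onto: "\<And>q. q \<in> V \<Longrightarrow> surj (Dv \<tau> q)"
begin

definition F :: "'e \<times> 'e \<Rightarrow> 'e \<times> 'e" where "F y = (\<tau> (fst y), P y)"

lemma open_VU: "open (V \<times> (UNIV :: 'e set))"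
  by (intro open_Times open_V open_UNIV)

lemma covector_eqI:
  assumes "q \<in> V" "\<And>v. s \<bullet> Dv \<tau> q v = t \<bullet> Dv \<tau> q v"
  shows "s = t"
proof -
  have "s \<bullet> w = t \<bullet> w" for w using assms(2) onto[OF assms(1)] by (metis surjD)
  then show ?thesis by (metis vector_eq_rdot)
qed

lemma smooth_F: "smooth_on (V \<times> UNIV) F"
proof -
  have "smooth_on (V \<times> UNIV) (\<lambda>y :: 'e \<times> 'e. \<tau> (fst y))"
    by (rule smooth_on_compose[OF E open_VU open_V _ smooth_on_bounded_linear[OF open_VU bounded_linear_fst] \<tau>]) auto
  then show ?thesis
    unfolding F_def by (intro smooth_on_Pair open_VU P)
qed

lemma Dv_F:
  assumes "fst y \<in> V"
  shows "Dv F y w = (Dv \<tau> (fst y) (fst w), Dv P y w)"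
proof -
  have "y \<in> V \<times> UNIV" using assms by (cases y) auto
  then have "(F has_derivative (\<lambda>w. (Dv \<tau> (fst y) (fst w), Dv P y w))) (at y)"
    unfolding F_def
    by (intro has_derivative_Pair has_derivative_compose[where g = \<tau> and f = fst, OF _ smooth_on_has_derivative[OF \<tau> assms]]
        has_derivative_fst has_derivative_ident smooth_on_has_derivative[OF P])
  then show ?thesis by (simp add: Dv_eq)
qed

text \<open>The derivative of the identity \<open>dual\<close>.  It expresses the horizontal derivative of \<open>P\<close>, hence all of the
  inhomogeneous part of the transformation law of 1-forms on the cotangent bundle, through the second
  derivative of \<open>\<tau>\<close>.\<close>

lemma dual_derivative:
  assumes "q \<in> V"
  shows "Dv P (q, p) w \<bullet> Dv \<tau> q v + P (q, p) \<bullet> Dv (\<lambda>q. Dv \<tau> q v) q (fst w) = snd w \<bullet> v"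
proof -
  have D\<tau>: "((\<lambda>q. Dv \<tau> q v) has_derivative Dv (\<lambda>q. Dv \<tau> q v) q) (at (fst (q, p)))"
    using smooth_on_has_derivative[OF smooth_on_Dv[OF \<tau>] assms] by simp
  have "((\<lambda>y. P y \<bullet> Dv \<tau> (fst y) v) has_derivative
      (\<lambda>w. P (q, p) \<bullet> Dv (\<lambda>q. Dv \<tau> q v) q (fst w) + Dv P (q, p) w \<bullet> Dv \<tau> (fst (q, p)) v)) (at (q, p))"
    by (intro has_derivative_inner smooth_on_has_derivative[OF P]
        has_derivative_compose[where g = "\<lambda>q. Dv \<tau> q v" and f = fst, OF _ D\<tau>] has_derivative_fst has_derivative_ident)
      (use assms in auto)
  moreover have "((\<lambda>y :: 'e \<times> 'e. snd y \<bullet> v) has_derivative (\<lambda>w. snd w \<bullet> v)) (at (q, p))"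
    by (auto intro!: derivative_eq_intros)
  moreover have "Dv (\<lambda>y. P y \<bullet> Dv \<tau> (fst y) v) (q, p) = Dv (\<lambda>y. snd y \<bullet> v) (q, p)"
    by (rule Dv_cong[OF open_VU]) (use assms dual in auto)
  ultimately have "(\<lambda>w. P (q, p) \<bullet> Dv (\<lambda>q. Dv \<tau> q v) q (fst w) + Dv P (q, p) w \<bullet> Dv \<tau> (fst (q, p)) v)
    = (\<lambda>w. snd w \<bullet> v)"
    by (simp only: Dv_eq)
  from fun_cong[OF this, of w] show ?thesis by simp
qed

lemma Dv_P_vertical:
  assumes "q \<in> V"
  shows "Dv P (q, p) (0, r) = P (q, r)"
proof (rule covector_eqI[OF assms])
  fix v
  have "Dv (\<lambda>q. Dv \<tau> q v) q 0 = 0"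
    by (rule linear_0[OF smooth_on_linear[OF smooth_on_Dv[OF \<tau>] assms]])
  then show "Dv P (q, p) (0, r) \<bullet> Dv \<tau> q v = P (q, r) \<bullet> Dv \<tau> q v"
    using dual_derivative[OF assms, of p "(0, r)" v] dual[OF assms, of r v] by simp
qed

lemma Dv_F_vertical:
  assumes "fst y \<in> V"
  shows "Dv F y (0, r) = (0, P (fst y, r))"
  using Dv_F[OF assms] Dv_P_vertical[OF assms, of "snd y" r] linear_0[OF smooth_on_linear[OF \<tau> assms]]
  by simp

lemma covector_law:
  assumes "q \<in> V" "\<And>v. a \<bullet> v = a' \<bullet> Dv \<tau> q v"
  shows "P (q, a) = a'"
  by (rule covector_eqI[OF assms(1)]) (simp add: dual[OF assms(1)] assms(2))

text \<open>The fibre component of a covector on the cotangent bundle pairs with vertical vectors, that is, with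
  covectors on the base; so it transforms like a tangent vector of the base.\<close>

lemma fiber_law:
  assumes "fst y \<in> V" "\<And>w. z \<bullet> w = z' \<bullet> Dv F y w"
  shows "snd z' = Dv \<tau> (fst y) (snd z)"
proof -
  have "snd z' \<bullet> s = Dv \<tau> (fst y) (snd z) \<bullet> s" for s
  proof -
    have lin: "linear (Dv \<tau> (fst y))" by (rule smooth_on_linear[OF \<tau> assms(1)])
    \<comment> \<open>a vertical vector over \<open>y\<close> that is mapped to the vertical vector \<open>s\<close>\<close>
    define r where "r = adjoint (Dv \<tau> (fst y)) s"
    have "P (fst y, r) = s"
      by (rule covector_law[OF assms(1)]) (simp add: r_def adjoint_inner[OF E lin])
    then have "snd z' \<bullet> s = z' \<bullet> Dv F y (0, r)" by (simp add: Dv_F_vertical[OF assms(1)] inner_prod_def)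
    also have "\<dots> = snd z \<bullet> r" unfolding assms(2)[symmetric] by (simp add: inner_prod_def)
    also have "\<dots> = Dv \<tau> (fst y) (snd z) \<bullet> s"
      by (simp add: r_def adjoint_inner[OF E lin] inner_commute[of s])
    finally show ?thesis .
  qed
  then show ?thesis by (metis vector_eq_rdot)
qed

end

text \<open>The bracket \<open>[z, \<pi>\<^sup>*a]\<close> in canonical coordinates, as \<open>bracket_pi_pullback_chart\<close> shows.  All derivatives of
  \<open>z\<close> are taken along the vertical lift \<open>(0, a)\<close> of \<open>a\<close>.\<close>

definition coord_bracket :: "('e::real_inner \<Rightarrow> 'e) \<Rightarrow> ('e \<times> 'e \<Rightarrow> 'e \<times> 'e) \<Rightarrow> 'e \<times> 'e \<Rightarrow> 'e \<times> 'e" where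
  "coord_bracket a z y = Dv z y (0, a (fst y)) + (Dv a (fst y) (snd (z y)), 0)"

context cotangent_lift begin

text \<open>Differentiate the transformation law of \<open>z\<close> in the vertical direction \<open>(0, a)\<close> and that of \<open>a\<close> in the
  direction of the fibre component of \<open>z\<close>.  The error terms both contain the second derivative of \<open>\<tau>\<close>, the
  former through \<open>dual_derivative\<close>, and they cancel because that derivative is symmetric.\<close>

lemma coord_bracket_law:
  assumes "open O1" "O1 \<subseteq> V \<times> UNIV" "F ` O1 \<subseteq> O2" "smooth_on O1 z" "smooth_on O2 z'"
    and zlaw: "\<And>y w. y \<in> O1 \<Longrightarrow> z y \<bullet> w = z' (F y) \<bullet> Dv F y w"
    and "smooth_on V a" "\<tau> ` V \<subseteq> V'" "smooth_on V' a'"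
    and alaw: "\<And>q v. q \<in> V \<Longrightarrow> a q \<bullet> v = a' (\<tau> q) \<bullet> Dv \<tau> q v"
    and "y \<in> O1"
  shows "coord_bracket a z y \<bullet> w = coord_bracket a' z' (F y) \<bullet> Dv F y w"
proof -
  define q where "q = fst y"
  define r where "r = a q"
  have q: "q \<in> V" "fst y \<in> V" "y \<in> V \<times> UNIV" using assms(2,11) unfolding q_def by auto
  have Pr: "P (q, r) = a' (\<tau> q)" unfolding r_def by (rule covector_law[OF q(1) alaw[OF q(1)]])
  have fiber: "snd (z' (F y)) = Dv \<tau> q (snd (z y))"
    unfolding q_def by (rule fiber_law[OF q(2) zlaw[OF assms(11)]])
  \<comment> \<open>differentiating the law of \<open>z\<close> along \<open>(0, r)\<close> produces a second derivative of \<open>F\<close>, which is symmetric; so the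
    vertical derivative can be taken first, where \<open>F\<close> is linear in the fibre\<close>
  have DF: "(F has_derivative Dv F y) (at y)" by (rule smooth_on_has_derivative[OF smooth_F q(3)])
  have "((\<lambda>y. z' (F y) \<bullet> Dv F y w) has_derivative
      (\<lambda>u. z' (F y) \<bullet> Dv (\<lambda>y. Dv F y w) y u + Dv z' (F y) (Dv F y u) \<bullet> Dv F y w)) (at y)"
    using assms(3,11)
    by (intro has_derivative_inner smooth_on_has_derivative[OF smooth_on_Dv[OF smooth_F] q(3)]
        has_derivative_compose[where f = F and g = z', OF DF] smooth_on_has_derivative[OF assms(5)]) auto
  moreover have "((\<lambda>y. z y \<bullet> w) has_derivative (\<lambda>u. Dv z y u \<bullet> w)) (at y)"
    by (intro has_derivative_inner_left smooth_on_has_derivative[OF assms(4,11)])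
  moreover have "Dv (\<lambda>y. z y \<bullet> w) y = Dv (\<lambda>y. z' (F y) \<bullet> Dv F y w) y"
    by (rule Dv_cong[OF assms(1,11) zlaw])
  ultimately have "(\<lambda>u. Dv z y u \<bullet> w) =
      (\<lambda>u. z' (F y) \<bullet> Dv (\<lambda>y. Dv F y w) y u + Dv z' (F y) (Dv F y u) \<bullet> Dv F y w)"
    by (simp only: Dv_eq)
  then have "Dv z y (0, r) \<bullet> w =
      z' (F y) \<bullet> Dv (\<lambda>y. Dv F y w) y (0, r) + Dv z' (F y) (Dv F y (0, r)) \<bullet> Dv F y w"
    by meson
  moreover have "Dv F y (0, r) = (0, a' (\<tau> q))"
    using Dv_F_vertical[OF q(2)] Pr by (simp add: q_def)
  moreover have "Dv (\<lambda>y. Dv F y w) y (0, r) = (0, Dv P (q, r) (fst w, 0))"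
  proof -
    have "Dv (\<lambda>y. Dv F y w) y (0, r) = Dv (\<lambda>y. Dv F y (0, r)) y w"
      by (rule smooth_on_symmetric[OF open_VU smooth_F q(3)])
    also have "Dv (\<lambda>y. Dv F y (0, r)) y = Dv (\<lambda>y. (0, P (fst y, r))) y"
      by (rule Dv_cong[OF open_VU q(3)]) (auto simp: Dv_F_vertical)
    also have "\<dots> = (\<lambda>w. (0, Dv P (q, r) (fst w, 0)))"
    proof (rule Dv_eq)
      have "(P has_derivative Dv P (q, r)) (at (fst y, r))"
        using smooth_on_has_derivative[OF P, of "(q, r)"] q by (simp add: q_def)
      then have "((\<lambda>y. P (fst y, r)) has_derivative (\<lambda>w. Dv P (q, r) (fst w, 0))) (at y)"
        by (intro has_derivative_compose[where g = P and f = "\<lambda>y. (fst y, r)"] has_derivative_Pair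
            has_derivative_fst has_derivative_ident has_derivative_const)
      then show "((\<lambda>y. (0, P (fst y, r))) has_derivative (\<lambda>w. (0, Dv P (q, r) (fst w, 0)))) (at y)"
        by (intro has_derivative_Pair has_derivative_const)
    qed
    finally show ?thesis .
  qed
  ultimately have 1: "Dv z y (0, r) \<bullet> w =
      snd (z' (F y)) \<bullet> Dv P (q, r) (fst w, 0) + Dv z' (F y) (0, a' (\<tau> q)) \<bullet> Dv F y w"
    by (simp add: inner_prod_def)
  \<comment> \<open>differentiating the law of \<open>a\<close> along \<open>?b\<close> produces a second derivative of \<open>\<tau>\<close>\<close>
  let ?b = "snd (z y)" and ?v = "fst w"
  have D\<tau>: "(\<tau> has_derivative Dv \<tau> q) (at q)" by (rule smooth_on_has_derivative[OF \<tau> q(1)])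
  have "((\<lambda>q. a' (\<tau> q) \<bullet> Dv \<tau> q ?v) has_derivative
      (\<lambda>u. a' (\<tau> q) \<bullet> Dv (\<lambda>q. Dv \<tau> q ?v) q u + Dv a' (\<tau> q) (Dv \<tau> q u) \<bullet> Dv \<tau> q ?v)) (at q)"
    using assms(8) q
    by (intro has_derivative_inner smooth_on_has_derivative[OF smooth_on_Dv[OF \<tau>] q(1)]
        has_derivative_compose[where f = \<tau> and g = a', OF D\<tau>] smooth_on_has_derivative[OF assms(9)]) auto
  moreover have "((\<lambda>q. a q \<bullet> ?v) has_derivative (\<lambda>u. Dv a q u \<bullet> ?v)) (at q)"
    by (intro has_derivative_inner_left smooth_on_has_derivative[OF assms(7) q(1)])
  moreover have "Dv (\<lambda>q. a q \<bullet> ?v) q = Dv (\<lambda>q. a' (\<tau> q) \<bullet> Dv \<tau> q ?v) q"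
    by (rule Dv_cong[OF open_V q(1) alaw])
  ultimately have "(\<lambda>u. Dv a q u \<bullet> ?v) =
      (\<lambda>u. a' (\<tau> q) \<bullet> Dv (\<lambda>q. Dv \<tau> q ?v) q u + Dv a' (\<tau> q) (Dv \<tau> q u) \<bullet> Dv \<tau> q ?v)"
    by (simp only: Dv_eq)
  then have 2: "Dv a q ?b \<bullet> ?v =
      a' (\<tau> q) \<bullet> Dv (\<lambda>q. Dv \<tau> q ?v) q ?b + Dv a' (\<tau> q) (Dv \<tau> q ?b) \<bullet> Dv \<tau> q ?v"
    by meson
  \<comment> \<open>the terms with second derivatives cancel\<close>
  have 3: "Dv P (q, r) (?v, 0) \<bullet> Dv \<tau> q ?b + a' (\<tau> q) \<bullet> Dv (\<lambda>q. Dv \<tau> q ?v) q ?b = 0"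
    using dual_derivative[OF q(1), of r "(?v, 0)" ?b] smooth_on_symmetric[OF open_V \<tau> q(1), of ?b ?v] Pr
    by simp
  have "fst (F y) = \<tau> q" "fst (Dv F y w) = Dv \<tau> q ?v" by (simp_all add: F_def q_def Dv_F[OF q(2)])
  moreover have "(c, 0) \<bullet> u = c \<bullet> fst u" for c :: 'e and u :: "'e \<times> 'e"
    by (simp add: inner_prod_def)
  ultimately show ?thesis
    using 1 2 3 unfolding coord_bracket_def r_def fiber q_def[symmetric]
    by (simp add: inner_add_left inner_commute[of "Dv P _ _"] algebra_simps fiber)
qed

text \<open>A section \<open>s\<close> of the cotangent bundle satisfies \<open>F (q, s q) = (\<tau> q, s' (\<tau> q))\<close>; this is the derivative of
  that identity.\<close>

lemma section_law:
  assumes "open V2" "V2 \<subseteq> V" "smooth_on V2 s" "smooth_on V' s'" "\<tau> ` V2 \<subseteq> V'"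
    and slaw: "\<And>q v. q \<in> V2 \<Longrightarrow> s q \<bullet> v = s' (\<tau> q) \<bullet> Dv \<tau> q v"
    and "q \<in> V2"
  shows "Dv F (q, s q) (v, Dv s q v) = (Dv \<tau> q v, Dv s' (\<tau> q) (Dv \<tau> q v))"
proof -
  have q: "q \<in> V" using assms by auto
  have "(F has_derivative Dv F (q, s q)) (at (q, s q))"
    using smooth_on_has_derivative[OF smooth_F] q by auto
  then have 1: "((\<lambda>q. F (q, s q)) has_derivative (\<lambda>v. Dv F (q, s q) (v, Dv s q v))) (at q)"
    by (intro has_derivative_compose[where g = F and f = "\<lambda>q. (q, s q)"] has_derivative_Pair
        has_derivative_ident smooth_on_has_derivative[OF assms(3,7)])
  have D\<tau>: "(\<tau> has_derivative Dv \<tau> q) (at q)" by (rule smooth_on_has_derivative[OF \<tau> q])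
  have "(s' has_derivative Dv s' (\<tau> q)) (at (\<tau> q))"
    using smooth_on_has_derivative[OF assms(4)] assms(5,7) by auto
  then have 2: "((\<lambda>q. (\<tau> q, s' (\<tau> q))) has_derivative (\<lambda>v. (Dv \<tau> q v, Dv s' (\<tau> q) (Dv \<tau> q v)))) (at q)"
    by (intro has_derivative_Pair D\<tau> has_derivative_compose[where g = s' and f = \<tau>, OF D\<tau>])
  have "Dv (\<lambda>q. F (q, s q)) q = Dv (\<lambda>q. (\<tau> q, s' (\<tau> q))) q"
    by (rule Dv_cong[OF assms(1,7)]) (use assms(2) in \<open>auto simp: F_def intro!: covector_law slaw\<close>)
  then have "(\<lambda>v. Dv F (q, s q) (v, Dv s q v)) = (\<lambda>v. (Dv \<tau> q v, Dv s' (\<tau> q) (Dv \<tau> q v)))"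
    by (simp only: Dv_eq[OF 1] Dv_eq[OF 2])
  then show ?thesis by meson
qed

end

lemma coord_bracket_smooth:
  fixes E V :: "'e::real_inner set"
  assumes "frame E" "open W" "smooth_on W z" "open V" "fst ` W \<subseteq> V" "smooth_on V a"
  shows "smooth_on W (coord_bracket a z)"
proof -
  note fst = smooth_on_bounded_linear[OF assms(2) bounded_linear_fst]
  have a: "smooth_on W (\<lambda>y. b (fst y))" if "smooth_on V b" for b :: "'e \<Rightarrow> 'e"
    by (rule smooth_on_compose[OF assms(1,2,4,5) fst that])
  have 1: "smooth_on W (\<lambda>y. Dv z y (0, a (fst y)))"
  proof (rule smooth_on_apply_linear[OF assms(1,2) a[OF assms(6)], of "\<lambda>u y. Dv z y (0, u)"])
    fix y assume "y \<in> W"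
    then have "linear (Dv z y)" by (rule smooth_on_linear[OF assms(3)])
    moreover have "linear (\<lambda>v :: 'e. (0 :: 'e, v))" by (auto intro!: linearI)
    ultimately show "linear (\<lambda>v. Dv z y (0, v))" using linear_compose by (force simp: o_def)
  qed (rule smooth_on_Dv[OF assms(3)])
  have 2: "smooth_on W (\<lambda>y. Dv a (fst y) (snd (z y)))"
  proof (rule smooth_on_apply_linear[OF assms(1,2), of "\<lambda>y. snd (z y)" "\<lambda>u y. Dv a (fst y) u"])
    show "smooth_on W (\<lambda>y. snd (z y))"
      by (rule smooth_on_bounded_linear_compose[OF assms(2) bounded_linear_snd assms(3)])
    show "linear (Dv a (fst y))" if "y \<in> W" for y
      using smooth_on_linear[OF assms(6)] assms(5) that by auto
    show "smooth_on W (\<lambda>y. Dv a (fst y) e)" for e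
      by (rule a[OF smooth_on_Dv[OF assms(6)]])
  qed
  show ?thesis unfolding coord_bracket_def
    by (intro smooth_on_add[OF assms(2) 1] smooth_on_Pair[OF assms(2) 2] smooth_on_const)
qed

lemma Dv_vertical_cong:
  fixes g h :: "'e::real_normed_vector \<times> 'f::real_normed_vector \<Rightarrow> 'g::real_normed_vector"
  assumes "open W" "y \<in> W" "g differentiable at y" "h differentiable at y"
    and eq: "\<And>y'. y' \<in> W \<Longrightarrow> fst y' = fst y \<Longrightarrow> g y' = h y'"
  shows "Dv g y (0, r) = Dv h y (0, r)"
proof -
  have D: "((\<lambda>p. k (fst y, p)) has_derivative (\<lambda>r. Dv k y (0, r))) (at (snd y))"
    if "k differentiable at y" for k :: "'e \<times> 'f \<Rightarrow> 'g"
    by (rule has_derivative_compose[where g = k and f = "\<lambda>p. (fst y, p)"])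
      (use Dv_works[OF that] in \<open>auto intro!: has_derivative_Pair\<close>)
  have "open ((\<lambda>p. (fst y, p)) -` W)"
    by (intro open_vimage assms(1) continuous_intros)
  then have "Dv (\<lambda>p. g (fst y, p)) (snd y) = Dv (\<lambda>p. h (fst y, p)) (snd y)"
    by (rule Dv_cong) (use assms(2) eq in auto)
  then have "(\<lambda>r. Dv g y (0, r)) = (\<lambda>r. Dv h y (0, r))"
    by (simp only: Dv_eq[OF D[OF assms(3)]] Dv_eq[OF D[OF assms(4)]])
  then show ?thesis by meson
qed

text \<open>The iterated bracket is \<open>D\<^sup>2z((0, a), (0, b))\<close> plus \<open>Da \<cdot> D(snd z)(0, b)\<close> plus
  \<open>Db \<cdot> D(snd z)(0, a)\<close> in the base component: the vertical lifts are constant along the fibres, hence no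
  derivatives of \<open>a\<close> or \<open>b\<close> enter the second order term, and the expression is symmetric in \<open>a\<close> and \<open>b\<close>.\<close>

lemma coord_bracket_commute:
  fixes E V :: "'e::real_inner set"
  assumes "frame E" "open W" "smooth_on W z" "open V" "fst ` W \<subseteq> V" "smooth_on V a" "smooth_on V b" "y \<in> W"
  shows "coord_bracket b (coord_bracket a z) y = coord_bracket a (coord_bracket b z) y"
proof -
  have main: "coord_bracket b (coord_bracket a z) y =
      Dv (\<lambda>y. Dv z y (0, a (fst y0))) y (0, b (fst y))
      + (Dv a (fst y) (snd (Dv z y (0, b (fst y)))), 0)
      + (Dv b (fst y) (snd (Dv z y (0, a (fst y)))), 0)"
    if "smooth_on V a" "y0 = y" for a b y0
  proof -
    define L where "L = Dv a (fst y)"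
    have fV: "fst y \<in> V" using assms(5,8) by auto
    have L: "bounded_linear L"
      unfolding L_def by (rule has_derivative_bounded_linear[OF smooth_on_has_derivative[OF that(1) fV]])
    \<comment> \<open>\<open>?h\<close> is \<open>coord_bracket a z\<close> with the coefficients that depend on the base point frozen at \<open>y\<close>; the two
      agree on the fibre through \<open>y\<close>, hence have the same vertical derivative\<close>
    let ?h = "\<lambda>y. Dv z y (0, a (fst y0)) + (L (snd (z y)), 0)"
    have h: "(?h has_derivative (\<lambda>u. Dv (\<lambda>y. Dv z y (0, a (fst y0))) y u + (L (snd (Dv z y u)), 0))) (at y)"
      by (intro has_derivative_add has_derivative_Pair has_derivative_const bounded_linear.has_derivative[OF L]
          has_derivative_snd smooth_on_has_derivative[OF smooth_on_Dv[OF assms(3)] assms(8)]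
          smooth_on_has_derivative[OF assms(3,8)])
    have "Dv (coord_bracket a z) y (0, b (fst y)) = Dv ?h y (0, b (fst y))"
    proof (rule Dv_vertical_cong[OF assms(2,8)])
      show "coord_bracket a z differentiable at y"
        using smooth_on_has_derivative[OF coord_bracket_smooth[OF assms(1-5) that(1)] assms(8)]
        by (auto simp: differentiable_def)
      show "?h differentiable at y" using h by (auto simp: differentiable_def)
    qed (simp add: coord_bracket_def L_def that(2))
    also have "\<dots> = Dv (\<lambda>y. Dv z y (0, a (fst y0))) y (0, b (fst y)) + (L (snd (Dv z y (0, b (fst y)))), 0)"
      by (simp only: Dv_eq[OF h])
    finally show ?thesis
      by (simp add: coord_bracket_def[of b] L_def) (simp add: coord_bracket_def)
  qed
  show ?thesis
    unfolding main[OF assms(6) refl] main[OF assms(7) refl]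
    using smooth_on_symmetric[OF assms(2,3,8), of "(0, a (fst y))" "(0, b (fst y))"] by simp
qed

lemma coord_bracket_cong:
  assumes "open W" "y \<in> W" "\<And>y. y \<in> W \<Longrightarrow> z y = z' y"
  shows "coord_bracket a z y = coord_bracket a z' y"
  by (simp only: coord_bracket_def Dv_cong[where f = z and g = z', OF assms] assms(3)[OF assms(2)])

lemma coord_bracket_add_left:
  assumes "z differentiable at y" "z' differentiable at y" "linear (Dv a (fst y))"
  shows "coord_bracket a (\<lambda>y. z y + z' y) y = coord_bracket a z y + coord_bracket a z' y"
  unfolding coord_bracket_def Dv_eq[OF has_derivative_add[OF Dv_works[OF assms(1)] Dv_works[OF assms(2)]]]
  by (simp add: linear_add[OF assms(3)])

lemma coord_bracket_add_right:
  assumes "a differentiable at (fst y)" "a' differentiable at (fst y)" "linear (Dv z y)"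
  shows "coord_bracket (\<lambda>q. a q + a' q) z y = coord_bracket a z y + coord_bracket a' z y"
proof -
  have "Dv z y (0, a (fst y) + a' (fst y)) = Dv z y (0, a (fst y)) + Dv z y (0, a' (fst y))"
    using linear_add[OF assms(3), of "(0, a (fst y))" "(0, a' (fst y))"] by simp
  then show ?thesis
    unfolding coord_bracket_def Dv_eq[OF has_derivative_add[OF Dv_works[OF assms(1)] Dv_works[OF assms(2)]]]
    by simp
qed

section \<open>Charts of the cotangent bundle\<close>

lemma cotangent_space_zero: "\<alpha> \<in> cotangent_space A x \<Longrightarrow> c \<notin> charts_at A x \<Longrightarrow> \<alpha> c = 0"
  unfolding cotangent_space_def by blast

locale cotangent_bundle =
  fixes A :: "('a, 'e::real_inner) chart set" and G :: "('a, 'e) cot set" and E :: "'e set"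
  assumes atlas: "smooth_atlas A"
    and E: "frame E"
    and G: "atlas_open (cot_atlas A) G"
begin

abbreviation CC :: "('a, 'e) chart \<Rightarrow> (('a, 'e) cot, 'e \<times> 'e) chart" where
  "CC c \<equiv> cot_chart A c"

text \<open>Coordinate domains: \<open>V c d\<close> is the overlap of \<open>d\<close> with \<open>c\<close> in the coordinates \<open>c\<close>, in particular
  \<open>V c c\<close> is the image of \<open>c\<close>; \<open>W c\<close> is the part of \<open>G\<close> over \<open>c\<close> in canonical coordinates, and \<open>WW c d\<close>
  below is the part of it over the overlap.\<close>

definition V :: "('a, 'e) chart \<Rightarrow> ('a, 'e) chart \<Rightarrow> 'e set" where
  "V c d = snd c ` (fst c \<inter> fst d)"

definition W :: "('a, 'e) chart \<Rightarrow> ('e \<times> 'e) set" where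
  "W c = snd (CC c) ` (fst (CC c) \<inter> G)"

text \<open>The components in \<open>d\<close> of the covector with the components \<open>snd y\<close> in \<open>c\<close>: covectors are pulled back
  along the transition in the opposite direction.\<close>

definition cotP :: "('a, 'e) chart \<Rightarrow> ('a, 'e) chart \<Rightarrow> 'e \<times> 'e \<Rightarrow> 'e" where
  "cotP c d y = adjoint (Dv (transition d c) (transition c d (fst y))) (snd y)"

abbreviation FF :: "('a, 'e) chart \<Rightarrow> ('a, 'e) chart \<Rightarrow> 'e \<times> 'e \<Rightarrow> 'e \<times> 'e" where
  "FF c d \<equiv> cotangent_lift.F (transition c d) (cotP c d)"

lemma chart_inv_chart: "c \<in> A \<Longrightarrow> x \<in> fst c \<Longrightarrow> chart_inv c (snd c x) = x"
  using atlas by (simp add: smooth_atlas_def chart_inv_def)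

lemma transition_chart: "c \<in> A \<Longrightarrow> x \<in> fst c \<Longrightarrow> transition c d (snd c x) = snd d x"
  by (simp add: transition_def chart_inv_chart)

lemma open_overlap: "c \<in> A \<Longrightarrow> d \<in> A \<Longrightarrow> open (V c d)"
  using atlas by (simp add: smooth_atlas_def V_def)

lemma smooth_transition: "c \<in> A \<Longrightarrow> d \<in> A \<Longrightarrow> smooth_on (V c d) (transition c d)"
  using atlas by (simp add: smooth_atlas_def V_def)

lemma transition_inverse:
  assumes "c \<in> A" "d \<in> A" "q \<in> V c d"
  shows "transition c d q \<in> V d c" "transition d c (transition c d q) = q"
  using assms by (auto simp: V_def transition_chart)

lemma in_V: "c \<in> A \<Longrightarrow> x \<in> fst c \<Longrightarrow> snd c x \<in> V c d \<longleftrightarrow> x \<in> fst d"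
  using atlas unfolding V_def smooth_atlas_def inj_on_def by blast

lemma Dv_transition_inverse:
  assumes "c \<in> A" "d \<in> A" "q \<in> V c d"
  shows "Dv (transition d c) (transition c d q) (Dv (transition c d) q v) = v"
proof -
  have 1: "(transition c d has_derivative Dv (transition c d) q) (at q)"
    by (rule smooth_on_has_derivative[OF smooth_transition[OF assms(1,2)] assms(3)])
  have 2: "(transition d c has_derivative Dv (transition d c) (transition c d q)) (at (transition c d q))"
    by (rule smooth_on_has_derivative[OF smooth_transition[OF assms(2,1)] transition_inverse(1)[OF assms]])
  have "Dv (\<lambda>q. transition d c (transition c d q)) q = Dv (\<lambda>q. q) q"
    by (rule Dv_cong[OF open_overlap[OF assms(1,2)] assms(3)]) (rule transition_inverse(2)[OF assms(1,2)])
  then have "(\<lambda>v. Dv (transition d c) (transition c d q) (Dv (transition c d) q v)) = (\<lambda>v. v)"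
    by (simp add: Dv_eq[OF has_derivative_compose[OF 1 2]])
  then show ?thesis by meson
qed

lemma cotangent_lift_transition:
  assumes "c \<in> A" "d \<in> A"
  shows "cotangent_lift E (V c d) (transition c d) (cotP c d)"
proof
  show "frame E" "open (V c d)" "smooth_on (V c d) (transition c d)"
    by (rule E, rule open_overlap[OF assms], rule smooth_transition[OF assms])
  have lin: "linear (Dv (transition d c) (transition c d q))" if "q \<in> V c d" for q
    by (rule smooth_on_linear[OF smooth_transition[OF assms(2,1)] transition_inverse(1)[OF assms that]])
  show "cotP c d (q, p) \<bullet> Dv (transition c d) q v = p \<bullet> v" if "q \<in> V c d" for q p v
    unfolding cotP_def by (simp add: adjoint_inner[OF E lin[OF that]] Dv_transition_inverse[OF assms that])
  show "surj (Dv (transition c d) q)" if "q \<in> V c d" for q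
    using Dv_transition_inverse[OF assms(2,1) transition_inverse(1)[OF assms that]]
    unfolding transition_inverse(2)[OF assms that] by (rule surjI)
  let ?S = "V c d \<times> (UNIV :: 'e set)"
  have S: "open ?S" by (intro open_Times open_overlap assms open_UNIV)
  have 0: "smooth_on ?S (\<lambda>y. transition c d (fst y))"
    by (rule smooth_on_compose[OF E S open_overlap[OF assms] _ smooth_on_bounded_linear[OF S bounded_linear_fst] smooth_transition[OF assms]]) auto
  have 1: "smooth_on ?S (\<lambda>y. Dv (transition d c) (transition c d (fst y)) e)" for e
    by (rule smooth_on_compose[OF E S open_overlap[OF assms(2,1)] _ 0 smooth_on_Dv[OF smooth_transition[OF assms(2,1)]]])
      (auto intro: transition_inverse(1)[OF assms])
  have "smooth_on ?S (\<lambda>y. \<Sum>e\<in>E. (snd y \<bullet> Dv (transition d c) (transition c d (fst y)) e) *\<^sub>R e)"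
    by (intro smooth_on_sum[OF S] smooth_on_bounded_linear_compose[OF S bounded_linear_scaleR_left]
        smooth_on_bilinear[OF S bounded_bilinear_inner] 1 smooth_on_bounded_linear[OF S bounded_linear_snd])
  then show "smooth_on ?S (cotP c d)"
    by (rule smooth_on_cong[OF S, rotated]) (auto simp: cotP_def adjoint_frame[OF E lin])
qed

lemma cotangent_law:
  assumes "\<alpha> \<in> cotangent_space A x" "c \<in> A" "d \<in> A" "x \<in> fst c" "x \<in> fst d"
  shows "\<alpha> c \<bullet> v = \<alpha> d \<bullet> Dv (transition c d) (snd c x) v"
  using assms unfolding cotangent_space_def charts_at_def by blast

lemma cotangent_chart_change:
  assumes "\<alpha> \<in> cotangent_space A x" "c \<in> A" "d \<in> A" "x \<in> fst c" "x \<in> fst d"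
  shows "\<alpha> d = cotP c d (snd c x, \<alpha> c)"
proof -
  interpret cotangent_lift E "V c d" "transition c d" "cotP c d"
    by (rule cotangent_lift_transition[OF assms(2,3)])
  have "snd c x \<in> V c d" using in_V assms by simp
  then show ?thesis using covector_law[OF _ cotangent_law[OF assms]] by simp
qed

lemma fst_CC: "z \<in> fst (CC c) \<longleftrightarrow> fst z \<in> fst c \<and> snd z \<in> cotangent_space A (fst z)"
  by (simp add: cot_chart_def)

lemma snd_CC: "snd (CC c) z = (snd c (fst z), snd z c)"
  by (simp add: cot_chart_def)

lemma CC_inv:
  assumes "c \<in> A" "z \<in> fst (CC c)"
  shows "chart_inv (CC c) (snd (CC c) z) = z"
proof -
  have "inj_on (snd (CC c)) (fst (CC c))"
  proof (rule inj_onI)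
    fix z z' assume z: "z \<in> fst (CC c)" "z' \<in> fst (CC c)" "snd (CC c) z = snd (CC c) z'"
    then have "fst z = fst z'"
      using atlas assms(1) by (auto simp: fst_CC snd_CC smooth_atlas_def inj_on_def)
    moreover have "snd z d = snd z' d" for d
    proof (cases "d \<in> charts_at A (fst z)")
      case True
      then show ?thesis
        using z assms(1) calculation cotangent_chart_change[of "snd z" "fst z" c d]
          cotangent_chart_change[of "snd z'" "fst z'" c d]
        by (simp add: fst_CC snd_CC charts_at_def)
    next
      case False
      then show ?thesis using z calculation by (metis fst_CC cotangent_space_zero)
    qed
    ultimately show "z = z'" by (simp add: prod_eq_iff fun_eq_iff)
  qed
  then show ?thesis using assms(2) by (simp add: chart_inv_def)
qed

lemma charts_at_cot: "D \<in> charts_at (cot_atlas A) z \<longleftrightarrow> (\<exists>d\<in>A. D = CC d \<and> z \<in> fst (CC d))"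
  by (auto simp: charts_at_def cot_atlas_def)

lemma loc_chart: "c \<in> A \<Longrightarrow> x \<in> fst c \<Longrightarrow> loc \<alpha> c (snd c x) = \<alpha> x c"
  by (simp add: loc_def chart_inv_chart)

lemma loc_CC: "c \<in> A \<Longrightarrow> z \<in> fst (CC c) \<Longrightarrow> loc \<theta> (CC c) (snd (CC c) z) = \<theta> z (CC c)"
  by (simp add: loc_def CC_inv)

lemma open_W: "c \<in> A \<Longrightarrow> open (W c)"
  using G by (auto simp: W_def atlas_open_def cot_atlas_def Int_commute)

lemma fst_W: "fst ` W c \<subseteq> V c c"
  by (auto simp: W_def V_def fst_CC snd_CC)

lemma in_W: "z \<in> G \<Longrightarrow> z \<in> fst (CC c) \<Longrightarrow> snd (CC c) z \<in> W c"
  by (simp add: W_def)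

definition WW :: "('a, 'e) chart \<Rightarrow> ('a, 'e) chart \<Rightarrow> ('e \<times> 'e) set" where
  "WW c d = W c \<inter> (V c d \<times> UNIV)"

lemma open_WW: "c \<in> A \<Longrightarrow> d \<in> A \<Longrightarrow> open (WW c d)"
  unfolding WW_def by (intro open_Int open_W open_Times open_overlap open_UNIV)

lemma WW_E:
  assumes "c \<in> A" "d \<in> A" "y \<in> WW c d"
  obtains z where "z \<in> G" "z \<in> fst (CC c)" "z \<in> fst (CC d)" "y = snd (CC c) z"
  using assms by (auto simp: WW_def W_def fst_CC snd_CC in_V)

lemma in_WW: "c \<in> A \<Longrightarrow> z \<in> G \<Longrightarrow> z \<in> fst (CC c) \<Longrightarrow> z \<in> fst (CC d) \<Longrightarrow> snd (CC c) z \<in> WW c d"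
  by (auto simp: WW_def W_def fst_CC snd_CC in_V)

lemma FF_CC:
  assumes "c \<in> A" "d \<in> A" "z \<in> fst (CC c)" "z \<in> fst (CC d)"
  shows "FF c d (snd (CC c) z) = snd (CC d) z"
  using assms cotangent_chart_change[of "snd z" "fst z" c d]
  by (simp add: cotangent_lift.F_def[OF cotangent_lift_transition[OF assms(1,2)]] snd_CC fst_CC transition_chart)

lemma Dv_transition_CC:
  assumes "c \<in> A" "d \<in> A" "y \<in> WW c d"
  shows "Dv (transition (CC c) (CC d)) y = Dv (FF c d) y"
proof (rule Dv_cong[OF open_WW[OF assms(1,2)] assms(3)])
  fix y assume "y \<in> WW c d"
  then obtain z where "z \<in> fst (CC c)" "z \<in> fst (CC d)" "y = snd (CC c) z"
    by (rule WW_E[OF assms(1,2)])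
  then show "transition (CC c) (CC d) y = FF c d y"
    using FF_CC[OF assms(1,2)] by (simp add: transition_def[of "CC c"] CC_inv assms)
qed

lemma FF_WW:
  assumes "c \<in> A" "d \<in> A"
  shows "FF c d ` WW c d \<subseteq> W d"
proof (rule image_subsetI)
  fix y assume "y \<in> WW c d"
  then obtain z where "z \<in> G" "z \<in> fst (CC c)" "z \<in> fst (CC d)" "y = snd (CC c) z"
    by (rule WW_E[OF assms])
  then show "FF c d y \<in> W d" using FF_CC[OF assms] in_W by simp
qed

section \<open>1-forms on the base and on the cotangent bundle\<close>

abbreviation \<Omega>M :: "('a, 'e) field set" where "\<Omega>M \<equiv> one_forms A (pts A)"
abbreviation \<Omega>G :: "(('a, 'e) cot, 'e \<times> 'e) field set" where "\<Omega>G \<equiv> one_forms (cot_atlas A) G"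

lemma pts_I: "c \<in> A \<Longrightarrow> x \<in> fst c \<Longrightarrow> x \<in> pts A"
  by (auto simp: pts_def)

lemma base_smooth: "\<alpha> \<in> \<Omega>M \<Longrightarrow> c \<in> A \<Longrightarrow> smooth_on (V c c) (loc \<alpha> c)"
proof -
  assume a: "\<alpha> \<in> \<Omega>M" "c \<in> A"
  have "fst c \<inter> pts A = fst c" using a by (auto simp: pts_def)
  then show ?thesis using a by (auto simp: one_forms_def V_def)
qed

lemma base_law:
  assumes "\<alpha> \<in> \<Omega>M" "c \<in> A" "d \<in> A" "q \<in> V c d"
  shows "loc \<alpha> c q \<bullet> v = loc \<alpha> d (transition c d q) \<bullet> Dv (transition c d) q v"
proof -
  obtain x where x: "x \<in> fst c" "x \<in> fst d" "q = snd c x" using assms(4) by (auto simp: V_def)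
  then have "\<alpha> x \<in> cotangent_space A x" using assms(1,2) by (auto simp: one_forms_def intro: pts_I)
  then show ?thesis using cotangent_law[of "\<alpha> x" x c d v] x assms by (simp add: loc_chart transition_chart)
qed

text \<open>Gluing of local representatives \<open>f c\<close>; this is how forms given by coordinate formulas are recognised
  as forms.\<close>

lemma base_formI:
  assumes "\<And>x c. \<not> (c \<in> A \<and> x \<in> fst c) \<Longrightarrow> \<alpha> x c = 0"
    and "\<And>c x. c \<in> A \<Longrightarrow> x \<in> fst c \<Longrightarrow> \<alpha> x c = f c (snd c x)"
    and "\<And>c. c \<in> A \<Longrightarrow> smooth_on (V c c) (f c)"
    and "\<And>c d q v. c \<in> A \<Longrightarrow> d \<in> A \<Longrightarrow> q \<in> V c d \<Longrightarrow> f c q \<bullet> v = f d (transition c d q) \<bullet> Dv (transition c d) q v"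
  shows "\<alpha> \<in> \<Omega>M"
proof -
  have "\<alpha> x c \<bullet> v = \<alpha> x d \<bullet> Dv (transition c d) (snd c x) v"
    if "c \<in> A" "x \<in> fst c" "d \<in> A" "x \<in> fst d" for x c d v
    using assms(4)[of c d "snd c x" v] that by (simp add: assms(2) in_V transition_chart)
  then have "\<alpha> x \<in> cotangent_space A x" for x
    unfolding cotangent_space_def charts_at_def using assms(1) by blast
  moreover have "smooth_on (snd c ` (fst c \<inter> pts A)) (loc \<alpha> c)" if "c \<in> A" for c
  proof -
    have "snd c ` (fst c \<inter> pts A) = V c c" using that by (auto simp: V_def pts_def)
    moreover have "smooth_on (V c c) (loc \<alpha> c)"
      by (rule smooth_on_cong[OF open_overlap[OF that that] _ assms(3)[OF that]])
        (auto simp: V_def loc_chart that assms(2))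
    ultimately show ?thesis by simp
  qed
  moreover have "\<alpha> x = (\<lambda>_. 0)" if "x \<notin> pts A" for x
  proof
    show "\<alpha> x c = 0" for c using assms(1)[of c x] that pts_I by blast
  qed
  ultimately show ?thesis by (auto simp: one_forms_def)
qed

lemma cot_smooth: "\<theta> \<in> \<Omega>G \<Longrightarrow> c \<in> A \<Longrightarrow> smooth_on (W c) (loc \<theta> (CC c))"
  by (auto simp: one_forms_def W_def cot_atlas_def)

lemma cot_law:
  assumes "\<theta> \<in> \<Omega>G" "c \<in> A" "d \<in> A" "y \<in> WW c d"
  shows "loc \<theta> (CC c) y \<bullet> w = loc \<theta> (CC d) (FF c d y) \<bullet> Dv (FF c d) y w"
proof -
  obtain z where z: "z \<in> G" "z \<in> fst (CC c)" "z \<in> fst (CC d)" "y = snd (CC c) z"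
    using WW_E[OF assms(2-4)] .
  then have "\<theta> z \<in> cotangent_space (cot_atlas A) z" using assms(1) by (auto simp: one_forms_def)
  moreover have "CC c \<in> charts_at (cot_atlas A) z" "CC d \<in> charts_at (cot_atlas A) z"
    using z assms by (auto simp: charts_at_cot)
  ultimately have "\<theta> z (CC c) \<bullet> w = \<theta> z (CC d) \<bullet> Dv (transition (CC c) (CC d)) y w"
    unfolding z(4) cotangent_space_def by blast
  then show ?thesis
    using z assms by (simp add: FF_CC loc_CC Dv_transition_CC)
qed

lemma cot_formI:
  assumes "\<And>z C. \<not> (z \<in> G \<and> C \<in> charts_at (cot_atlas A) z) \<Longrightarrow> \<theta> z C = 0"
    and "\<And>c z. c \<in> A \<Longrightarrow> z \<in> G \<Longrightarrow> z \<in> fst (CC c) \<Longrightarrow> \<theta> z (CC c) = f c (snd (CC c) z)"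
    and "\<And>c. c \<in> A \<Longrightarrow> smooth_on (W c) (f c)"
    and "\<And>c d y w. c \<in> A \<Longrightarrow> d \<in> A \<Longrightarrow> y \<in> WW c d \<Longrightarrow> f c y \<bullet> w = f d (FF c d y) \<bullet> Dv (FF c d) y w"
  shows "\<theta> \<in> \<Omega>G"
proof -
  have "\<theta> z \<in> cotangent_space (cot_atlas A) z" if "z \<in> G" for z
  proof -
    have "\<theta> z (CC c) \<bullet> w = \<theta> z (CC d) \<bullet> Dv (transition (CC c) (CC d)) (snd (CC c) z) w"
      if "c \<in> A" "z \<in> fst (CC c)" "d \<in> A" "z \<in> fst (CC d)" for c d w
    proof -
      have y: "snd (CC c) z \<in> WW c d" by (rule in_WW) (use that \<open>z \<in> G\<close> in auto)
      show ?thesis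
        using assms(4)[OF that(1,3) y] that \<open>z \<in> G\<close> by (simp add: assms(2) FF_CC Dv_transition_CC[OF that(1,3) y])
    qed
    then show ?thesis
      unfolding cotangent_space_def
      by (intro CollectI conjI ballI allI impI) (use assms(1) charts_at_cot in metis)+
  qed
  moreover have "smooth_on (snd C ` (fst C \<inter> G)) (loc \<theta> C)" if "C \<in> cot_atlas A" for C
  proof -
    from that obtain c where c: "C = CC c" "c \<in> A" unfolding cot_atlas_def by blast
    have "smooth_on (W c) (loc \<theta> (CC c))"
      by (rule smooth_on_cong[OF open_W[OF c(2)] _ assms(3)[OF c(2)]])
        (auto simp: W_def loc_CC c assms(2))
    then show ?thesis by (simp add: c W_def)
  qed
  moreover have "\<theta> z = (\<lambda>_. 0)" if "z \<notin> G" for z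
    by (rule ext, rule assms(1)) (simp add: that)
  ultimately show ?thesis by (auto simp: one_forms_def)
qed

lemma frame_EE: "frame ((\<lambda>e. (e, 0)) ` E \<union> (\<lambda>e. (0, e)) ` E)"
  by (rule frame_prod[OF E E])

lemma pi_pullback_chart:
  assumes "c \<in> A" "z \<in> G" "z \<in> fst (CC c)" "\<alpha> \<in> \<Omega>M"
  shows "pi_pullback A G \<alpha> z (CC c) = (\<alpha> (fst z) c, 0)"
proof -
  define d where "d = (SOME d. d \<in> charts_at A (fst z))"
  have "c \<in> charts_at A (fst z)" using assms by (simp add: charts_at_def fst_CC)
  then have "d \<in> charts_at A (fst z)" unfolding d_def by (rule someI)
  then have d: "d \<in> A" "fst z \<in> fst d" by (auto simp: charts_at_def)
  define y where "y = snd (CC c) z"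
  have zd: "z \<in> fst (CC d)" using d assms by (simp add: fst_CC)
  have y: "y \<in> WW c d" unfolding y_def by (rule in_WW[OF assms(1-3) zd])
  then have q: "fst y \<in> V c d" by (auto simp: WW_def)
  let ?f = "snd d \<circ> fst \<circ> chart_inv (CC c)"
  have Df: "((\<lambda>y. transition c d (fst y)) has_derivative (\<lambda>w. Dv (transition c d) (fst y) (fst w))) (at y)"
    by (rule has_derivative_compose[where f = fst, OF _ smooth_on_has_derivative[OF smooth_transition[OF assms(1) d(1)] q]])
      (auto intro!: derivative_eq_intros)
  have "Dv ?f y = Dv (\<lambda>y. transition c d (fst y)) y"
  proof (rule Dv_cong[OF open_WW[OF assms(1) d(1)] y])
    fix y assume "y \<in> WW c d"
    then obtain z where "z \<in> fst (CC c)" "y = snd (CC c) z"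
      by (rule WW_E[OF assms(1) d(1)])
    then show "?f y = transition c d (fst y)"
      using assms(1) by (simp add: CC_inv) (simp add: snd_CC fst_CC transition_chart)
  qed
  then have D: "Dv ?f y = (\<lambda>w. Dv (transition c d) (fst y) (fst w))" by (simp add: Dv_eq[OF Df])
  have lin: "linear (Dv ?f y)" unfolding D using has_derivative_linear[OF Df] .
  have "adjoint (Dv ?f y) (\<alpha> (fst z) d) = (\<alpha> (fst z) c, 0)"
  proof (rule vector_eq_rdot[THEN iffD1], rule)
    fix w :: "'e \<times> 'e"
    have "\<alpha> (fst z) \<in> cotangent_space A (fst z)"
      using assms(4) pts_I[OF d] by (auto simp: one_forms_def)
    then have "\<alpha> (fst z) c \<bullet> fst w = \<alpha> (fst z) d \<bullet> Dv (transition c d) (fst y) (fst w)"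
      using assms d by (auto simp: y_def snd_CC fst_CC intro: cotangent_law)
    then show "adjoint (Dv ?f y) (\<alpha> (fst z) d) \<bullet> w = (\<alpha> (fst z) c, 0) \<bullet> w"
      unfolding adjoint_inner[OF frame_EE lin] by (simp add: D inner_prod_def)
  qed
  then show ?thesis
    unfolding pi_pullback_def pullback_def restr_def Let_def d_def[symmetric] y_def[symmetric]
    using assms by (auto simp: charts_at_cot)
qed

lemma ham_field_chart:
  assumes "z \<in> G" "C \<in> charts_at (cot_atlas A) z"
  shows "ham_field A G \<zeta> z C = (snd (\<zeta> z C), - fst (\<zeta> z C))"
  using assms symp_sharp[of "fst (\<zeta> z C)" "snd (\<zeta> z C)"] by (simp add: ham_field_def restr_def)

text \<open>The value of \<open>\<theta>\<close> on the vertical lift of \<open>\<alpha>\<close>.  The definition of \<open>omega\<close> evaluates in an arbitrary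
  canonical chart; the pairing of a covector of the base with a fibre component does not depend on it.\<close>

lemma omega_pi:
  assumes "c \<in> A" "z \<in> G" "z \<in> fst (CC c)" "\<theta> \<in> \<Omega>G" "\<alpha> \<in> \<Omega>M"
  shows "omega A (ham_field A G \<theta>) (ham_field A G (pi_pullback A G \<alpha>)) z = \<alpha> (fst z) c \<bullet> snd (\<theta> z (CC c))"
proof -
  define D where "D = (SOME D. D \<in> charts_at (cot_atlas A) z)"
  have "CC c \<in> charts_at (cot_atlas A) z" using assms by (auto simp: charts_at_cot)
  then have D: "D \<in> charts_at (cot_atlas A) z" unfolding D_def by (rule someI)
  then obtain d where d: "d \<in> A" "D = CC d" "z \<in> fst (CC d)" by (auto simp: charts_at_cot)
  interpret cotangent_lift E "V c d" "transition c d" "cotP c d"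
    by (rule cotangent_lift_transition[OF assms(1) d(1)])
  have y: "snd (CC c) z \<in> WW c d" by (rule in_WW[OF assms(1-3) d(3)])
  then have q: "snd c (fst z) \<in> V c d" by (auto simp: WW_def snd_CC)
  have "snd (\<theta> z (CC d)) = Dv (transition c d) (snd c (fst z)) (snd (\<theta> z (CC c)))"
    using fiber_law[OF _ cot_law[OF assms(4,1) d(1) y]] assms d q
    by (simp add: FF_CC loc_CC) (simp add: snd_CC)
  moreover have "\<alpha> (fst z) c \<bullet> v = \<alpha> (fst z) d \<bullet> Dv (transition c d) (snd c (fst z)) v" for v
    using base_law[OF assms(5,1) d(1) q] assms d by (simp add: loc_chart transition_chart fst_CC)
  ultimately show ?thesis
    unfolding omega_def D_def[symmetric] Let_def ham_field_chart[OF assms(2) D]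
    using d assms by (simp add: symp_def pi_pullback_chart)
qed

text \<open>With \<open>\<theta> = (a, b)\<close> the fields are \<open>X\<^sub>\<theta> = (b, -a)\<close> and \<open>X\<^bsub>\<pi>\<^sup>*\<alpha>\<^esub> = (0, -\<alpha>)\<close>, and \<open>\<omega>\<close> of them
  is \<open>\<alpha> \<bullet> b\<close>.  In its differential, the derivative of \<open>b\<close> cancels the transposed derivative of \<open>X\<^sub>\<theta>\<close> in the
  first Lie derivative, and the derivative of \<open>\<alpha>\<close> that of \<open>X\<^bsub>\<pi>\<^sup>*\<alpha>\<^esub>\<close> in the second.\<close>

lemma bracket_pi_pullback_chart:
  assumes "c \<in> A" "z \<in> G" "z \<in> fst (CC c)" "\<theta> \<in> \<Omega>G" "\<alpha> \<in> \<Omega>M"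
  shows "bracket A G \<theta> (pi_pullback A G \<alpha>) z (CC c)
    = coord_bracket (loc \<alpha> c) (loc \<theta> (CC c)) (snd (CC c) z)"
proof -
  define y where "y = snd (CC c) z"
  define a where "a = \<alpha> (fst z) c"
  define b where "b = snd (\<theta> z (CC c))"
  let ?\<theta> = "loc \<theta> (CC c)" and ?\<alpha> = "loc \<alpha> c"
  let ?\<pi> = "pi_pullback A G \<alpha>"
  let ?X = "ham_field A G \<theta>" and ?Y = "ham_field A G ?\<pi>"
  have C: "CC c \<in> charts_at (cot_atlas A) z" using assms by (auto simp: charts_at_cot)
  note W = open_W[OF assms(1)]
  have y: "y \<in> W c" unfolding y_def by (rule in_W[OF assms(2,3)])
  have q: "fst y \<in> V c c" using y fst_W by blast
  have at: "?\<theta> y = \<theta> z (CC c)" "?\<alpha> (fst y) = a"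
    using assms unfolding y_def a_def by (simp_all add: loc_CC) (simp add: snd_CC fst_CC loc_chart)
  have D\<theta>: "(?\<theta> has_derivative Dv ?\<theta> y) (at y)"
    by (rule smooth_on_has_derivative[OF cot_smooth[OF assms(4,1)] y])
  have D\<alpha>: "((\<lambda>y. ?\<alpha> (fst y)) has_derivative (\<lambda>w. Dv ?\<alpha> (fst y) (fst w))) (at y)"
    by (rule has_derivative_compose[where f = fst, OF _ smooth_on_has_derivative[OF base_smooth[OF assms(5,1)] q]])
      (auto intro!: derivative_eq_intros)
  have on_W: "\<exists>z. z \<in> G \<and> z \<in> fst (CC c) \<and> CC c \<in> charts_at (cot_atlas A) z \<and> chart_inv (CC c) y = z
      \<and> fst z \<in> fst c \<and> y = snd (CC c) z" if "y \<in> W c" for y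
    using that assms(1) by (auto simp: W_def charts_at_cot CC_inv fst_CC)
  have D\<pi>: "Dv (loc ?\<pi> (CC c)) y = (\<lambda>w. (Dv ?\<alpha> (fst y) (fst w), 0))"
  proof -
    have "Dv (loc ?\<pi> (CC c)) y = Dv (\<lambda>y. (?\<alpha> (fst y), 0)) y"
      by (rule Dv_cong[OF W y])
        (use on_W assms in \<open>auto simp: loc_def[of ?\<pi>] pi_pullback_chart snd_CC loc_chart dest!: on_W\<close>)
    then show ?thesis by (simp add: Dv_eq[OF has_derivative_Pair[OF D\<alpha> has_derivative_const]])
  qed
  have DX: "(loc ?X (CC c) has_derivative (\<lambda>w. (snd (Dv ?\<theta> y w), - fst (Dv ?\<theta> y w)))) (at y)"
  proof (rule has_derivative_transform_within_open[OF _ W y])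
    show "((\<lambda>y. (snd (?\<theta> y), - fst (?\<theta> y))) has_derivative (\<lambda>w. (snd (Dv ?\<theta> y w), - fst (Dv ?\<theta> y w)))) (at y)"
      by (intro has_derivative_Pair has_derivative_minus has_derivative_fst has_derivative_snd D\<theta>)
  qed (auto simp: loc_def ham_field_chart dest!: on_W)
  have DY: "(loc ?Y (CC c) has_derivative (\<lambda>w. (0, - Dv ?\<alpha> (fst y) (fst w)))) (at y)"
  proof (rule has_derivative_transform_within_open[OF _ W y])
    show "((\<lambda>y. (0, - ?\<alpha> (fst y))) has_derivative (\<lambda>w. (0, - Dv ?\<alpha> (fst y) (fst w)))) (at y)"
      by (intro has_derivative_Pair has_derivative_minus has_derivative_const D\<alpha>)
  qed (use assms in \<open>auto simp: loc_def[of ?Y] ham_field_chart pi_pullback_chart snd_CC loc_chart dest!: on_W\<close>)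
  have D\<omega>: "(omega A ?X ?Y \<circ> chart_inv (CC c) has_derivative
      (\<lambda>w. a \<bullet> snd (Dv ?\<theta> y w) + Dv ?\<alpha> (fst y) (fst w) \<bullet> b)) (at y)"
  proof (rule has_derivative_transform_within_open[OF _ W y])
    show "((\<lambda>y. ?\<alpha> (fst y) \<bullet> snd (?\<theta> y)) has_derivative
      (\<lambda>w. a \<bullet> snd (Dv ?\<theta> y w) + Dv ?\<alpha> (fst y) (fst w) \<bullet> b)) (at y)"
      unfolding at(2)[symmetric] b_def at(1)[symmetric]
      by (intro has_derivative_inner D\<alpha> has_derivative_snd D\<theta>)
  qed (use assms in \<open>auto simp: omega_pi loc_def[of \<theta>] snd_CC loc_chart dest!: on_W\<close>)
  have X: "?X z (CC c) = (b, - fst (\<theta> z (CC c)))" and Y: "?Y z (CC c) = (0, - a)" and \<pi>: "?\<pi> z (CC c) = (a, 0)"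
    using assms by (simp_all add: ham_field_chart[OF assms(2) C] pi_pullback_chart a_def b_def)
  have lin: "linear (Dv ?\<theta> y)" by (rule has_derivative_linear[OF D\<theta>])
  have linX: "linear (Dv (loc ?X (CC c)) y)" unfolding Dv_eq[OF DX] by (rule has_derivative_linear[OF DX])
  have linY: "linear (Dv (loc ?Y (CC c)) y)" unfolding Dv_eq[OF DY] by (rule has_derivative_linear[OF DY])
  have lin\<omega>: "linear (Dv (omega A ?X ?Y \<circ> chart_inv (CC c)) y)"
    unfolding Dv_eq[OF D\<omega>] by (rule has_derivative_linear[OF D\<omega>])
  note adj = adjoint_inner(1)[OF frame_EE linX] adjoint_inner(1)[OF frame_EE linY] adjoint_inner(1)[OF frame_EE lin\<omega>]
  have "bracket A G \<theta> ?\<pi> z (CC c) =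
      Dv (loc ?\<pi> (CC c)) y (?X z (CC c)) + adjoint (Dv (loc ?X (CC c)) y) (?\<pi> z (CC c))
      - (Dv ?\<theta> y (?Y z (CC c)) + adjoint (Dv (loc ?Y (CC c)) y) (\<theta> z (CC c)))
      - adjoint (Dv (omega A ?X ?Y \<circ> chart_inv (CC c)) y) 1"
    using assms(2) C by (simp add: bracket_def lie_deriv_def d_fun_def restr_def y_def)
  also have "\<dots> = coord_bracket ?\<alpha> ?\<theta> y"
  proof (rule vector_eq_rdot[THEN iffD1], rule)
    fix w
    have neg: "Dv ?\<theta> y (0, - a) = - Dv ?\<theta> y (0, a)"
      using linear_neg[OF lin, of "(0, a)"] by simp
    show "(Dv (loc ?\<pi> (CC c)) y (?X z (CC c)) + adjoint (Dv (loc ?X (CC c)) y) (?\<pi> z (CC c))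
      - (Dv ?\<theta> y (?Y z (CC c)) + adjoint (Dv (loc ?Y (CC c)) y) (\<theta> z (CC c)))
      - adjoint (Dv (omega A ?X ?Y \<circ> chart_inv (CC c)) y) 1) \<bullet> w = coord_bracket ?\<alpha> ?\<theta> y \<bullet> w"
      unfolding coord_bracket_def at X Y \<pi> inner_add_left inner_diff_left adj
      unfolding Dv_eq[OF DX] Dv_eq[OF DY] Dv_eq[OF D\<omega>] D\<pi> neg b_def
      by (simp add: inner_prod_def inner_commute)
  qed
  finally show ?thesis unfolding y_def .
qed

end

section \<open>Brackets with forms pulled back from the base, and pullback along sections\<close>

context cotangent_bundle begin

definition pi_bracket :: "(('a, 'e) cot, 'e \<times> 'e) field \<Rightarrow> ('a, 'e) field \<Rightarrow> (('a, 'e) cot, 'e \<times> 'e) field" where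
  "pi_bracket \<theta> \<alpha> = bracket A G \<theta> (pi_pullback A G \<alpha>)"

lemma pi_bracket_outside: "\<not> (z \<in> G \<and> C \<in> charts_at (cot_atlas A) z) \<Longrightarrow> pi_bracket \<theta> \<alpha> z C = 0"
  by (auto simp: pi_bracket_def bracket_def lie_deriv_def d_fun_def restr_def)

lemma cot_form_outside:
  assumes "\<theta> \<in> \<Omega>G" "\<not> (z \<in> G \<and> C \<in> charts_at (cot_atlas A) z)"
  shows "\<theta> z C = 0"
proof (cases "z \<in> G")
  case True
  then have "\<theta> z \<in> cotangent_space (cot_atlas A) z" using assms(1) by (simp add: one_forms_def)
  then show ?thesis by (rule cotangent_space_zero) (use assms(2) True in simp)
next
  case False
  then have "\<theta> z = (\<lambda>_. 0)" using assms(1) unfolding one_forms_def by blast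
  then show ?thesis by simp
qed

lemma base_form_outside:
  assumes "\<alpha> \<in> \<Omega>M" "\<not> (c \<in> A \<and> x \<in> fst c)"
  shows "\<alpha> x c = 0"
proof (cases "x \<in> pts A")
  case True
  then have "\<alpha> x \<in> cotangent_space A x" using assms(1) by (simp add: one_forms_def)
  then show ?thesis by (rule cotangent_space_zero) (use assms(2) in \<open>simp add: charts_at_def\<close>)
next
  case False
  then have "\<alpha> x = (\<lambda>_. 0)" using assms(1) by (simp add: one_forms_def)
  then show ?thesis by simp
qed

lemma base_smooth_V: "\<alpha> \<in> \<Omega>M \<Longrightarrow> c \<in> A \<Longrightarrow> smooth_on (V c d) (loc \<alpha> c)"
  by (rule smooth_on_subset[OF base_smooth]) (auto simp: V_def)

lemma transition_V: "c \<in> A \<Longrightarrow> d \<in> A \<Longrightarrow> transition c d ` V c d \<subseteq> V d d"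
  by (auto simp: V_def transition_chart)

lemma cot_eqI:
  assumes "\<And>z C. \<not> (z \<in> G \<and> C \<in> charts_at (cot_atlas A) z) \<Longrightarrow> \<theta> z C = \<theta>' z C"
    and "\<And>z c. z \<in> G \<Longrightarrow> c \<in> A \<Longrightarrow> z \<in> fst (CC c) \<Longrightarrow> \<theta> z (CC c) = \<theta>' z (CC c)"
  shows "\<theta> = \<theta>'"
proof (intro ext)
  fix z C show "\<theta> z C = \<theta>' z C"
  proof (cases "z \<in> G \<and> C \<in> charts_at (cot_atlas A) z")
    case True
    then obtain c where "c \<in> A" "C = CC c" "z \<in> fst (CC c)" unfolding charts_at_cot by blast
    then show ?thesis using True assms(2) by simp
  next
    case False
    then show ?thesis by (rule assms(1))
  qed
qed

lemma pi_bracket_chart: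
  "c \<in> A \<Longrightarrow> z \<in> G \<Longrightarrow> z \<in> fst (CC c) \<Longrightarrow> \<theta> \<in> \<Omega>G \<Longrightarrow> \<alpha> \<in> \<Omega>M \<Longrightarrow>
    pi_bracket \<theta> \<alpha> z (CC c) = coord_bracket (loc \<alpha> c) (loc \<theta> (CC c)) (snd (CC c) z)"
  unfolding pi_bracket_def by (rule bracket_pi_pullback_chart)

lemma pi_bracket_form:
  assumes "\<theta> \<in> \<Omega>G" "\<alpha> \<in> \<Omega>M"
  shows "pi_bracket \<theta> \<alpha> \<in> \<Omega>G"
proof (rule cot_formI[where f = "\<lambda>c. coord_bracket (loc \<alpha> c) (loc \<theta> (CC c))"])
  fix c assume c: "c \<in> A"
  show "smooth_on (W c) (coord_bracket (loc \<alpha> c) (loc \<theta> (CC c)))"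
    by (rule coord_bracket_smooth[OF E open_W[OF c] cot_smooth[OF assms(1) c] open_overlap[OF c c] fst_W
          base_smooth[OF assms(2) c]])
next
  fix c d y w assume cd: "c \<in> A" "d \<in> A" and y: "y \<in> WW c d"
  interpret cotangent_lift E "V c d" "transition c d" "cotP c d"
    by (rule cotangent_lift_transition[OF cd])
  show "coord_bracket (loc \<alpha> c) (loc \<theta> (CC c)) y \<bullet> w
      = coord_bracket (loc \<alpha> d) (loc \<theta> (CC d)) (FF c d y) \<bullet> Dv (FF c d) y w"
    by (rule coord_bracket_law[OF open_WW[OF cd] _ FF_WW[OF cd] smooth_on_subset[OF cot_smooth[OF assms(1) cd(1)]]
          cot_smooth[OF assms(1) cd(2)] cot_law[OF assms(1) cd] base_smooth_V[OF assms(2) cd(1)]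
          transition_V[OF cd] base_smooth[OF assms(2) cd(2)] base_law[OF assms(2) cd] y])
      (auto simp: WW_def)
qed (use assms in \<open>auto intro: pi_bracket_outside pi_bracket_chart\<close>)

text \<open>Jacobi identity for \<open>\<theta>\<close>, \<open>\<pi>\<^sup>*\<alpha>\<close> and \<open>\<pi>\<^sup>*\<beta>\<close>, of which the last two commute.\<close>

lemma pi_bracket_commute:
  assumes "\<theta> \<in> \<Omega>G" "\<alpha> \<in> \<Omega>M" "\<beta> \<in> \<Omega>M"
  shows "pi_bracket (pi_bracket \<theta> \<alpha>) \<beta> = pi_bracket (pi_bracket \<theta> \<beta>) \<alpha>"
proof (rule cot_eqI)
  fix z c assume z: "z \<in> G" and c: "c \<in> A" and zc: "z \<in> fst (CC c)"
  let ?y = "snd (CC c) z"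
  have y: "?y \<in> W c" by (rule in_W[OF z zc])
  have *: "pi_bracket (pi_bracket \<theta> \<alpha>) \<beta> z (CC c) = coord_bracket (loc \<beta> c) (coord_bracket (loc \<alpha> c) (loc \<theta> (CC c))) ?y"
    if "\<alpha> \<in> \<Omega>M" "\<beta> \<in> \<Omega>M" for \<alpha> \<beta>
  proof -
    have "loc (pi_bracket \<theta> \<alpha>) (CC c) y = coord_bracket (loc \<alpha> c) (loc \<theta> (CC c)) y" if "y \<in> W c" for y
    proof -
      from that obtain z' where "z' \<in> G" "z' \<in> fst (CC c)" "y = snd (CC c) z'" unfolding W_def by blast
      then show ?thesis using pi_bracket_chart[OF c _ _ assms(1) \<open>\<alpha> \<in> \<Omega>M\<close>] by (simp add: loc_CC[OF c])
    qed
    then show ?thesis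
      unfolding pi_bracket_chart[OF c z zc pi_bracket_form[OF assms(1) that(1)] that(2)]
      by (rule coord_bracket_cong[OF open_W[OF c] y])
  qed
  show "pi_bracket (pi_bracket \<theta> \<alpha>) \<beta> z (CC c) = pi_bracket (pi_bracket \<theta> \<beta>) \<alpha> z (CC c)"
    unfolding *[OF assms(2,3)] *[OF assms(3,2)]
    by (rule coord_bracket_commute[OF E open_W[OF c] cot_smooth[OF assms(1) c] open_overlap[OF c c] fst_W
          base_smooth[OF assms(2) c] base_smooth[OF assms(3) c] y])
qed (simp add: pi_bracket_outside)

lemma loc_add: "loc (\<theta> + \<theta>') c = (\<lambda>y. loc \<theta> c y + loc \<theta>' c y)"
  by (simp add: loc_def fun_eq_iff)

lemma cot_add:
  assumes "\<theta> \<in> \<Omega>G" "\<theta>' \<in> \<Omega>G"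
  shows "\<theta> + \<theta>' \<in> \<Omega>G"
  by (rule cot_formI[where f = "\<lambda>c y. loc \<theta> (CC c) y + loc \<theta>' (CC c) y"])
    (use assms in \<open>auto simp: cot_form_outside loc_CC cot_law inner_add_left intro!: smooth_on_add open_W cot_smooth\<close>)

lemma base_add:
  assumes "\<alpha> \<in> \<Omega>M" "\<beta> \<in> \<Omega>M"
  shows "\<alpha> + \<beta> \<in> \<Omega>M"
  by (rule base_formI[where f = "\<lambda>c q. loc \<alpha> c q + loc \<beta> c q"])
    (use assms base_law[OF assms(1)] base_law[OF assms(2)] in
      \<open>auto simp: base_form_outside loc_chart inner_add_left intro!: smooth_on_add open_overlap base_smooth\<close>)

lemma base_scale:
  assumes "\<alpha> \<in> \<Omega>M"
  shows "(\<lambda>x c. r *\<^sub>R \<alpha> x c) \<in> \<Omega>M"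
  by (rule base_formI[where f = "\<lambda>c q. r *\<^sub>R loc \<alpha> c q"])
    (use assms base_law[OF assms(1)] in
      \<open>auto simp: base_form_outside loc_chart intro!: smooth_on_bounded_linear_compose[OF _ bounded_linear_scaleR_right] open_overlap base_smooth\<close>)

lemma base_zero: "0 \<in> \<Omega>M"
  by (rule base_formI[where f = "\<lambda>c q. 0"]) (auto intro: smooth_on_const)

lemma pi_bracket_add_left:
  assumes "\<theta> \<in> \<Omega>G" "\<theta>' \<in> \<Omega>G" "\<alpha> \<in> \<Omega>M"
  shows "pi_bracket (\<theta> + \<theta>') \<alpha> = pi_bracket \<theta> \<alpha> + pi_bracket \<theta>' \<alpha>"
proof (rule cot_eqI)
  fix z c assume z: "z \<in> G" and c: "c \<in> A" and zc: "z \<in> fst (CC c)"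
  let ?y = "snd (CC c) z"
  have y: "?y \<in> W c" "fst ?y \<in> V c c" using in_W[OF z zc] fst_W by blast+
  show "pi_bracket (\<theta> + \<theta>') \<alpha> z (CC c) = (pi_bracket \<theta> \<alpha> + pi_bracket \<theta>' \<alpha>) z (CC c)"
    unfolding plus_fun_apply pi_bracket_chart[OF c z zc assms(1,3)] pi_bracket_chart[OF c z zc assms(2,3)]
      pi_bracket_chart[OF c z zc cot_add[OF assms(1,2)] assms(3)] loc_add
    using smooth_on_has_derivative[OF cot_smooth[OF assms(1) c] y(1)]
      smooth_on_has_derivative[OF cot_smooth[OF assms(2) c] y(1)]
    by (intro coord_bracket_add_left smooth_on_linear[OF base_smooth[OF assms(3) c] y(2)])
      (auto simp: differentiable_def)
qed (simp add: pi_bracket_outside)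

lemma pi_bracket_add_right:
  assumes "\<theta> \<in> \<Omega>G" "\<alpha> \<in> \<Omega>M" "\<beta> \<in> \<Omega>M"
  shows "pi_bracket \<theta> (\<alpha> + \<beta>) = pi_bracket \<theta> \<alpha> + pi_bracket \<theta> \<beta>"
proof (rule cot_eqI)
  fix z c assume z: "z \<in> G" and c: "c \<in> A" and zc: "z \<in> fst (CC c)"
  let ?y = "snd (CC c) z"
  have y: "?y \<in> W c" "fst ?y \<in> V c c" using in_W[OF z zc] fst_W by blast+
  show "pi_bracket \<theta> (\<alpha> + \<beta>) z (CC c) = (pi_bracket \<theta> \<alpha> + pi_bracket \<theta> \<beta>) z (CC c)"
    unfolding plus_fun_apply pi_bracket_chart[OF c z zc assms(1,2)] pi_bracket_chart[OF c z zc assms(1,3)]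
      pi_bracket_chart[OF c z zc assms(1) base_add[OF assms(2,3)]] loc_add
    using smooth_on_has_derivative[OF base_smooth[OF assms(2) c] y(2)]
      smooth_on_has_derivative[OF base_smooth[OF assms(3) c] y(2)]
    by (intro coord_bracket_add_right smooth_on_linear[OF cot_smooth[OF assms(1) c] y(1)])
      (auto simp: differentiable_def)
qed (simp add: pi_bracket_outside)

lemma graph_point:
  assumes "\<zeta> \<in> graph_forms A G" "c \<in> A" "x \<in> fst c"
  shows "(x, \<zeta> x) \<in> G" "(x, \<zeta> x) \<in> fst (CC c)"
  using assms pts_I[OF assms(2,3)] by (auto simp: graph_forms_def fst_CC one_forms_def)

lemma graph_form_base: "\<zeta> \<in> graph_forms A G \<Longrightarrow> \<zeta> \<in> \<Omega>M"
  by (simp add: graph_forms_def)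

lemma section_derivative:
  assumes "\<zeta> \<in> graph_forms A G" "c \<in> A" "d \<in> A" "q \<in> V c d"
  shows "Dv (FF c d) (q, loc \<zeta> c q) (v, Dv (loc \<zeta> c) q v)
      = (Dv (transition c d) q v, Dv (loc \<zeta> d) (transition c d q) (Dv (transition c d) q v))"
proof -
  note \<zeta> = graph_form_base[OF assms(1)]
  interpret cotangent_lift E "V c d" "transition c d" "cotP c d"
    by (rule cotangent_lift_transition[OF assms(2,3)])
  show ?thesis
    by (rule section_law[OF open_overlap[OF assms(2,3)] subset_refl base_smooth_V[OF \<zeta> assms(2)]
          base_smooth[OF \<zeta> assms(3)] transition_V[OF assms(2,3)] base_law[OF \<zeta> assms(2,3)] assms(4)])
qed

lemma section_WW:
  assumes "\<zeta> \<in> graph_forms A G" "c \<in> A" "d \<in> A" "q \<in> V c d"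
  shows "(q, loc \<zeta> c q) \<in> WW c d" "FF c d (q, loc \<zeta> c q) = (transition c d q, loc \<zeta> d (transition c d q))"
proof -
  obtain x where x: "x \<in> fst c" "x \<in> fst d" "q = snd c x" using assms(4) by (auto simp: V_def)
  have eq: "(snd c x, loc \<zeta> c (snd c x)) = snd (CC c) (x, \<zeta> x)"
    "(snd d x, loc \<zeta> d (snd d x)) = snd (CC d) (x, \<zeta> x)"
    using x assms by (simp_all add: snd_CC loc_chart)
  show "(q, loc \<zeta> c q) \<in> WW c d"
    unfolding x(3) eq using x assms by (intro in_WW graph_point)
  have "FF c d (snd (CC c) (x, \<zeta> x)) = snd (CC d) (x, \<zeta> x)"
    by (intro FF_CC assms graph_point[OF assms(1)] x)
  then show "FF c d (q, loc \<zeta> c q) = (transition c d q, loc \<zeta> d (transition c d q))"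
    unfolding x(3) transition_chart[OF assms(2) x(1)] eq .
qed

text \<open>The definition of the pullback uses an arbitrary canonical chart \<open>D\<close>; the transformation law of \<open>\<theta>\<close> and
  \<open>section_derivative\<close> move it to the chart \<open>CC c\<close> of the point at hand.\<close>

lemma section_pullback_chart:
  assumes "\<zeta> \<in> graph_forms A G" "\<theta> \<in> \<Omega>G" "c \<in> A" "x \<in> fst c"
  shows "section_pullback A \<zeta> \<theta> x c \<bullet> v =
    loc \<theta> (CC c) (snd c x, \<zeta> x c) \<bullet> (v, Dv (loc \<zeta> c) (snd c x) v)"
proof -
  define q where "q = snd c x"
  define D where "D = (SOME D. D \<in> charts_at (cot_atlas A) (x, \<zeta> x))"
  have "CC c \<in> charts_at (cot_atlas A) (x, \<zeta> x)"
    using graph_point[OF assms(1,3,4)] assms(3) by (auto simp: charts_at_cot)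
  then have "D \<in> charts_at (cot_atlas A) (x, \<zeta> x)" unfolding D_def by (rule someI)
  then obtain d where d: "d \<in> A" "D = CC d" "(x, \<zeta> x) \<in> fst (CC d)" by (auto simp: charts_at_cot)
  then have xd: "x \<in> fst d" by (simp add: fst_CC)
  have q: "q \<in> V c d" unfolding q_def using in_V[OF assms(3,4)] xd by simp
  note \<zeta> = graph_form_base[OF assms(1)]
  have q': "transition c d q \<in> V d d" using transition_V[OF assms(3) d(1)] q by blast
  let ?f = "snd D \<circ> (\<lambda>x. (x, \<zeta> x)) \<circ> chart_inv c"
  have D\<tau>: "(transition c d has_derivative Dv (transition c d) q) (at q)"
    by (rule smooth_on_has_derivative[OF smooth_transition[OF assms(3) d(1)] q])
  have D: "(?f has_derivative
      (\<lambda>v. (Dv (transition c d) q v, Dv (loc \<zeta> d) (transition c d q) (Dv (transition c d) q v)))) (at q)"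
  proof (rule has_derivative_transform_within_open[OF _ open_overlap[OF assms(3) d(1)] q])
    show "((\<lambda>q. (transition c d q, loc \<zeta> d (transition c d q))) has_derivative
      (\<lambda>v. (Dv (transition c d) q v, Dv (loc \<zeta> d) (transition c d q) (Dv (transition c d) q v)))) (at q)"
      by (intro has_derivative_Pair D\<tau> has_derivative_compose[OF D\<tau>] smooth_on_has_derivative[OF base_smooth[OF \<zeta> d(1)] q'])
    show "(transition c d q, loc \<zeta> d (transition c d q)) = ?f q" if "q \<in> V c d" for q
      using that d(1) assms(3) by (auto simp: V_def transition_chart loc_chart d(2) snd_CC chart_inv_chart)
  qed
  have lin: "linear (Dv ?f q)" unfolding Dv_eq[OF D] by (rule has_derivative_linear[OF D])
  have "section_pullback A \<zeta> \<theta> x c = adjoint (Dv ?f q) (\<theta> (x, \<zeta> x) D)"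
    using assms(3,4) pts_I[OF assms(3,4)]
    unfolding section_pullback_def pullback_def restr_def Let_def D_def[symmetric] q_def[symmetric]
    by (simp add: charts_at_def q_def)
  also have "\<dots> \<bullet> v = \<theta> (x, \<zeta> x) D \<bullet> Dv ?f q v" by (rule adjoint_inner(1)[OF E lin])
  also have "\<dots> = \<theta> (x, \<zeta> x) D \<bullet> Dv (FF c d) (q, loc \<zeta> c q) (v, Dv (loc \<zeta> c) q v)"
    unfolding section_derivative[OF assms(1,3) d(1) q] Dv_eq[OF D] ..
  also have "\<theta> (x, \<zeta> x) D = loc \<theta> (CC d) (FF c d (q, loc \<zeta> c q))"
    unfolding section_WW(2)[OF assms(1,3) d(1) q]
    using loc_CC[OF d(1,3), of \<theta>] xd d assms by (simp add: snd_CC q_def transition_chart loc_chart)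
  also have "\<dots> \<bullet> Dv (FF c d) (q, loc \<zeta> c q) (v, Dv (loc \<zeta> c) q v) =
      loc \<theta> (CC c) (q, loc \<zeta> c q) \<bullet> (v, Dv (loc \<zeta> c) q v)"
    by (rule cot_law[OF assms(2,3) d(1) section_WW(1)[OF assms(1,3) d(1) q], symmetric])
  finally show ?thesis using assms by (simp add: q_def loc_chart)
qed

lemma section_pullback_outside: "\<not> (c \<in> A \<and> x \<in> fst c) \<Longrightarrow> section_pullback A \<zeta> \<theta> x c = 0"
  by (auto simp: section_pullback_def pullback_def restr_def charts_at_def)

lemma section_pullback_form:
  assumes "\<zeta> \<in> graph_forms A G" "\<theta> \<in> \<Omega>G"
  shows "section_pullback A \<zeta> \<theta> \<in> \<Omega>M"
proof -
  note \<zeta> = graph_form_base[OF assms(1)]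
  define f where "f c q = (\<Sum>e\<in>E. (loc \<theta> (CC c) (q, loc \<zeta> c q) \<bullet> (e, Dv (loc \<zeta> c) q e)) *\<^sub>R e)" for c q
  have f: "f c q \<bullet> v = loc \<theta> (CC c) (q, loc \<zeta> c q) \<bullet> (v, Dv (loc \<zeta> c) q v)" if "c \<in> A" "q \<in> V c c" for c q v
  proof -
    have "linear (\<lambda>v. loc \<theta> (CC c) (q, loc \<zeta> c q) \<bullet> (v, Dv (loc \<zeta> c) q v))"
      using smooth_on_linear[OF base_smooth[OF \<zeta> that(1)] that(2)]
      by (auto intro!: linearI simp: inner_prod_def linear_add linear_scale algebra_simps)
    from linear_frame[OF E this, of v] show ?thesis
      by (simp add: f_def inner_sum_left inner_commute[of v] mult.commute)
  qed
  show ?thesis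
  proof (rule base_formI[where f = f])
    fix c x assume c: "c \<in> A" and x: "x \<in> fst c"
    then have "snd c x \<in> V c c" by (auto simp: V_def)
    then have "section_pullback A \<zeta> \<theta> x c \<bullet> v = f c (snd c x) \<bullet> v" for v
      using section_pullback_chart[OF assms c x, of v] f[OF c, of "snd c x" v] loc_chart[OF c x, of \<zeta>] by simp
    then show "section_pullback A \<zeta> \<theta> x c = f c (snd c x)" by (metis vector_eq_rdot)
  next
    fix c assume c: "c \<in> A"
    note V = open_overlap[OF c c] and sm = base_smooth[OF \<zeta> c]
    have s: "smooth_on (V c c) (\<lambda>q. (q, loc \<zeta> c q))"
      by (intro smooth_on_Pair V sm smooth_on_bounded_linear bounded_linear_ident)
    have "(\<lambda>q. (q, loc \<zeta> c q)) ` V c c \<subseteq> W c"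
      using section_WW(1)[OF assms(1) c c] by (auto simp: WW_def)
    then have "smooth_on (V c c) (\<lambda>q. loc \<theta> (CC c) (q, loc \<zeta> c q))"
      by (rule smooth_on_compose[OF frame_EE V open_W[OF c] _ s cot_smooth[OF assms(2) c]])
    then show "smooth_on (V c c) (f c)" unfolding f_def
      by (intro smooth_on_sum[OF V] smooth_on_bounded_linear_compose[OF V bounded_linear_scaleR_left]
          smooth_on_bilinear[OF V bounded_bilinear_inner] smooth_on_Pair[OF V] smooth_on_const smooth_on_Dv[OF sm])
  next
    fix c d q v assume c: "c \<in> A" and d: "d \<in> A" and q: "q \<in> V c d"
    have qc: "q \<in> V c c" and qd: "transition c d q \<in> V d d"
      using q transition_V[OF c d] by (auto simp: V_def)
    show "f c q \<bullet> v = f d (transition c d q) \<bullet> Dv (transition c d) q v"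
      unfolding f[OF c qc] f[OF d qd] section_derivative[OF assms(1) c d q, symmetric]
        section_WW(2)[OF assms(1) c d q, symmetric]
      by (rule cot_law[OF assms(2) c d section_WW(1)[OF assms(1) c d q]])
  qed (simp add: section_pullback_outside)
qed

lemma section_pullback_add:
  assumes "\<zeta> \<in> graph_forms A G" "\<theta> \<in> \<Omega>G" "\<theta>' \<in> \<Omega>G"
  shows "section_pullback A \<zeta> (\<theta> + \<theta>') = section_pullback A \<zeta> \<theta> + section_pullback A \<zeta> \<theta>'"
proof (intro ext)
  fix x c
  show "section_pullback A \<zeta> (\<theta> + \<theta>') x c = (section_pullback A \<zeta> \<theta> + section_pullback A \<zeta> \<theta>') x c"
  proof (cases "c \<in> A \<and> x \<in> fst c")
    case True
    then have "section_pullback A \<zeta> (\<theta> + \<theta>') x c \<bullet> v = (section_pullback A \<zeta> \<theta> + section_pullback A \<zeta> \<theta>') x c \<bullet> v" for v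
      using assms cot_add[OF assms(2,3)] by (simp add: section_pullback_chart inner_add_left loc_add)
    then show ?thesis by (metis vector_eq_rdot)
  qed (simp add: section_pullback_outside)
qed

end

section \<open>The pre-Lie identity\<close>

context cotangent_bundle begin

definition iterated_bracket ::
  "(('a, 'e) cot, 'e \<times> 'e) field \<Rightarrow> ('a, 'e) field \<Rightarrow> ('a, 'e) fmap list \<Rightarrow> (('a, 'e) cot, 'e \<times> 'e) field" where
  "iterated_bracket \<xi> \<zeta> fs = foldr (\<lambda>f \<theta>. pi_bracket \<theta> (f \<zeta>)) fs \<xi>"

lemma eta_iterated_bracket:
  "eta A G \<xi> fs = (\<lambda>\<zeta>. if \<zeta> \<in> graph_forms A G then section_pullback A \<zeta> (iterated_bracket \<xi> \<zeta> fs) else 0)"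
  unfolding eta_def iterated_bracket_def pi_bracket_def ..

lemma form_maps_D: "f \<in> form_maps A G \<Longrightarrow> \<zeta> \<in> graph_forms A G \<Longrightarrow> f \<zeta> \<in> \<Omega>M"
  by (simp add: form_maps_def)

lemma iterated_bracket_form:
  assumes "\<xi> \<in> \<Omega>G" "\<zeta> \<in> graph_forms A G" "set fs \<subseteq> form_maps A G"
  shows "iterated_bracket \<xi> \<zeta> fs \<in> \<Omega>G"
  using assms(3) by (induction fs) (simp_all add: iterated_bracket_def assms(1) pi_bracket_form form_maps_D[OF _ assms(2)])

lemma iterated_bracket_add:
  assumes "\<xi> \<in> \<Omega>G" "\<zeta> \<in> graph_forms A G" "set fs \<subseteq> form_maps A G"
    and "a \<in> form_maps A G" "b \<in> form_maps A G" "i < length fs"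
  shows "iterated_bracket \<xi> \<zeta> (fs[i := a + b]) = iterated_bracket \<xi> \<zeta> (fs[i := a]) + iterated_bracket \<xi> \<zeta> (fs[i := b])"
  using assms(3,6)
proof (induction fs arbitrary: i)
  case (Cons f fs)
  have iterated_bracket_Cons: "iterated_bracket \<xi> \<zeta> (g # gs) = pi_bracket (iterated_bracket \<xi> \<zeta> gs) (g \<zeta>)" for g gs by (simp add: iterated_bracket_def)
  have fs: "set fs \<subseteq> form_maps A G" "f \<in> form_maps A G" using Cons.prems by auto
  show ?case
  proof (cases i)
    case 0
    show ?thesis unfolding 0 list_update_code(2) iterated_bracket_Cons plus_fun_apply[of a b \<zeta>]
      by (intro pi_bracket_add_right iterated_bracket_form assms form_maps_D fs)
  next
    case (Suc j)
    have "set (fs[j := c]) \<subseteq> form_maps A G" if "c \<in> form_maps A G" for c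
      using set_update_subset_insert[of fs j c] fs that by auto
    moreover have "iterated_bracket \<xi> \<zeta> (fs[j := a + b]) = iterated_bracket \<xi> \<zeta> (fs[j := a]) + iterated_bracket \<xi> \<zeta> (fs[j := b])"
      using Suc Cons.prems(2) by (intro Cons.IH fs) simp
    ultimately show ?thesis
      unfolding Suc list_update_code(3) iterated_bracket_Cons
      by (simp only:) (intro pi_bracket_add_left iterated_bracket_form form_maps_D assms fs, simp_all add: assms)
  qed
qed simp

lemma subspace_form_maps: "fmap.subspace (form_maps A G)"
  unfolding fmap.subspace_def form_maps_def fscale_def
  by (auto simp: base_add base_scale base_zero) (auto simp: fun_eq_iff)

lemma eta_form:
  assumes "\<xi> \<in> \<Omega>G" "set fs \<subseteq> form_maps A G"
  shows "eta A G \<xi> fs \<in> form_maps A G"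
  using assms by (simp add: eta_iterated_bracket form_maps_def[of A G] section_pullback_form iterated_bracket_form)

lemma eta_add:
  assumes "\<xi> \<in> \<Omega>G" "set fs \<subseteq> form_maps A G" "a \<in> form_maps A G" "b \<in> form_maps A G" "i < length fs"
  shows "eta A G \<xi> (fs[i := a + b]) = eta A G \<xi> (fs[i := a]) + eta A G \<xi> (fs[i := b])"
proof
  fix \<zeta>
  have "set (fs[i := c]) \<subseteq> form_maps A G" if "c \<in> form_maps A G" for c
    using set_update_subset_insert[of fs i c] assms that by auto
  then show "eta A G \<xi> (fs[i := a + b]) \<zeta> = (eta A G \<xi> (fs[i := a]) + eta A G \<xi> (fs[i := b])) \<zeta>"
    using assms by (simp add: eta_iterated_bracket iterated_bracket_add section_pullback_add iterated_bracket_form)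
qed

text \<open>The first two arguments are those of the two outermost brackets, and these commute.\<close>

lemma eta_swap:
  assumes "\<xi> \<in> \<Omega>G" "set fs \<subseteq> form_maps A G" "f \<in> form_maps A G" "g \<in> form_maps A G"
  shows "eta A G \<xi> (f # g # fs) = eta A G \<xi> (g # f # fs)"
proof
  fix \<zeta>
  have "iterated_bracket \<xi> \<zeta> (f # g # fs) = iterated_bracket \<xi> \<zeta> (g # f # fs)" if "\<zeta> \<in> graph_forms A G"
    using pi_bracket_commute[OF iterated_bracket_form[OF assms(1) that assms(2)] form_maps_D[OF assms(4) that] form_maps_D[OF assms(3) that]]
    by (simp add: iterated_bracket_def)
  then show "eta A G \<xi> (f # g # fs) \<zeta> = eta A G \<xi> (g # f # fs) \<zeta>" by (simp add: eta_iterated_bracket)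
qed

lemma xi_map_form: "\<xi> \<in> \<Omega>G \<Longrightarrow> xi_map A G \<xi> \<in> form_maps A G"
  by (simp add: xi_map_def form_maps_def section_pullback_form)

text \<open>Since the maps with values in 1-forms are closed under all \<open>eta\<close>, the intersection defining \<open>J_space\<close> is
  over a nonempty family.\<close>

lemma J_space_subset: "\<xi> \<in> \<Omega>G \<Longrightarrow> J_space A G \<xi> \<subseteq> form_maps A G"
  unfolding J_space_def
  by (rule Inter_lower) (simp add: subspace_form_maps xi_map_form eta_form)

lemma J_space_subspace: "fmap.subspace (J_space A G \<xi>)"
  unfolding J_space_def fmap.subspace_def by auto

lemma J_space_xi: "xi_map A G \<xi> \<in> J_space A G \<xi>"
  unfolding J_space_def by auto

lemma J_space_eta: "fs \<noteq> [] \<Longrightarrow> set fs \<subseteq> J_space A G \<xi> \<Longrightarrow> eta A G \<xi> fs \<in> J_space A G \<xi>"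
  unfolding J_space_def by blast

lemma J_space_induct:
  assumes "\<xi> \<in> \<Omega>G" "h \<in> J_space A G \<xi>"
    and "fmap.subspace {h \<in> J_space A G \<xi>. Q h}"
    and "Q (xi_map A G \<xi>)"
    and "\<And>fs. fs \<noteq> [] \<Longrightarrow> set fs \<subseteq> J_space A G \<xi> \<Longrightarrow> (\<And>f. f \<in> set fs \<Longrightarrow> Q f) \<Longrightarrow> Q (eta A G \<xi> fs)"
  shows "Q h"
proof -
  let ?V = "{h \<in> J_space A G \<xi>. Q h}"
  have "\<forall>fs. fs \<noteq> [] \<and> set fs \<subseteq> ?V \<longrightarrow> eta A G \<xi> fs \<in> ?V"
  proof (intro allI impI, elim conjE)
    fix fs assume "fs \<noteq> []" "set fs \<subseteq> ?V"
    then show "eta A G \<xi> fs \<in> ?V" using J_space_eta[of fs \<xi>] assms(5)[of fs] by blast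
  qed
  moreover have "?V \<subseteq> form_maps A G" using J_space_subset[OF assms(1)] by blast
  ultimately have "J_space A G \<xi> \<subseteq> ?V"
    using assms(3,4) J_space_xi[of \<xi>] unfolding J_space_def[of A G \<xi>] by (intro Inter_lower) simp
  then show ?thesis using assms(2) by blast
qed

text \<open>The associator is \<open>-\<eta>\<^sub>2(f, g)\<close> at \<open>\<xi>\<close>.  At \<open>\<eta>\<^sub>k(f\<^sub>1, \<dots>, f\<^sub>k)\<close>, expanding with the Leibniz rule gives
  terms of three kinds, once those with \<open>f \<triangleright> g\<close> in front have cancelled: those in which \<open>f\<close> and \<open>g\<close> act
  on different slots, or one acts on a slot and the other is put in front, are together symmetric in \<open>f\<close>
  and \<open>g\<close>; those with the associator in one slot are symmetric by induction; and
  \<open>-\<eta>\<^bsub>k+2\<^esub>(f, g, f\<^sub>1, \<dots>, f\<^sub>k)\<close> is symmetric by \<open>eta_swap\<close>.  The identity is stated with sums only, so that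
  additivity of \<open>eta\<close> in each slot suffices.\<close>

lemma triangle_pre_Lie:
  assumes \<xi>: "\<xi> \<in> \<Omega>G" and p: "is_triangle_product A G \<xi> p"
    and fg: "f \<in> J_space A G \<xi>" "g \<in> J_space A G \<xi>" and h: "h \<in> J_space A G \<xi>"
  shows "p (p f g) h + p g (p f h) = p (p g f) h + p f (p g h)"
proof -
  let ?J = "J_space A G \<xi>" and ?\<eta> = "eta A G \<xi>"
  note sub = J_space_subspace[of \<xi>]
  have closed: "p f g \<in> ?J" if "f \<in> ?J" "g \<in> ?J" for f g
    using p that by (simp add: is_triangle_product_def bilinear_product_on_def)
  have add: "p f (g + h) = p f g + p f h" if "f \<in> ?J" "g \<in> ?J" "h \<in> ?J" for f g h
    using p that by (simp add: is_triangle_product_def bilinear_product_on_def)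
  have scale: "p f (fscale r g) = fscale r (p f g)" if "f \<in> ?J" "g \<in> ?J" for f g r
    using p that by (simp add: is_triangle_product_def bilinear_product_on_def)
  have xi: "p f (xi_map A G \<xi>) = ?\<eta> [f]" if "f \<in> ?J" for f
    using p that by (simp add: is_triangle_product_def)
  have eta: "p f (?\<eta> fs) = (\<Sum>i<length fs. ?\<eta> (fs[i := p f (fs ! i)])) + ?\<eta> (f # fs)"
    if "f \<in> ?J" "fs \<noteq> []" "set fs \<subseteq> ?J" for f fs
    using p that by (simp add: is_triangle_product_def)
  have zero: "p f 0 = 0" if "f \<in> ?J" for f
    using scale[OF that fmap.subspace_0[OF sub], of 0] by simp
  have sum: "p f (\<Sum>i\<in>I. k i) = (\<Sum>i\<in>I. p f (k i))" if "f \<in> ?J" "finite I" "\<And>i. i \<in> I \<Longrightarrow> k i \<in> ?J" for f k and I :: "nat set"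
    using that(2,3)
    by (induction I rule: finite_induct) (simp_all add: zero add that(1) fmap.subspace_sum[OF sub])
  have update: "set (fs[i := k]) \<subseteq> ?J" if "set fs \<subseteq> ?J" "k \<in> ?J" for fs i k
    using set_update_subset_insert[of fs i k] that by auto
  note form = subsetD[OF J_space_subset[OF \<xi>]]
  show ?thesis
  proof (rule J_space_induct[OF \<xi> h])
    show "fmap.subspace {h \<in> ?J. p (p f g) h + p g (p f h) = p (p g f) h + p f (p g h)}"
    proof (rule fmap.subspaceI)
      show "0 \<in> {h \<in> ?J. p (p f g) h + p g (p f h) = p (p g f) h + p f (p g h)}"
        using fg by (simp add: zero closed fmap.subspace_0[OF sub])
    next
      fix x y
      assume "x \<in> {h \<in> ?J. p (p f g) h + p g (p f h) = p (p g f) h + p f (p g h)}"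
        and "y \<in> {h \<in> ?J. p (p f g) h + p g (p f h) = p (p g f) h + p f (p g h)}"
      then have *: "x \<in> ?J" "y \<in> ?J"
        "p (p f g) x + p g (p f x) = p (p g f) x + p f (p g x)"
        "p (p f g) y + p g (p f y) = p (p g f) y + p f (p g y)" by auto
      have "(p (p f g) x + p g (p f x)) + (p (p f g) y + p g (p f y)) =
        (p (p g f) x + p f (p g x)) + (p (p g f) y + p f (p g y))" using *(3,4) by simp
      then show "x + y \<in> {h \<in> ?J. p (p f g) h + p g (p f h) = p (p g f) h + p f (p g h)}"
        using *(1,2) fg by (simp add: add closed fmap.subspace_add[OF sub] ac_simps)
    next
      fix r x
      assume "x \<in> {h \<in> ?J. p (p f g) h + p g (p f h) = p (p g f) h + p f (p g h)}"
      then show "fscale r x \<in> {h \<in> ?J. p (p f g) h + p g (p f h) = p (p g f) h + p f (p g h)}"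
        using fg by (simp add: scale closed fmap.subspace_scale[OF sub] fmap.scale_right_distrib[symmetric])
    qed
  next
    have "p f (p g (xi_map A G \<xi>)) = ?\<eta> [p f g] + ?\<eta> [f, g]" if "f \<in> ?J" "g \<in> ?J" for f g
      using that by (simp add: xi eta)
    then show "p (p f g) (xi_map A G \<xi>) + p g (p f (xi_map A G \<xi>)) = p (p g f) (xi_map A G \<xi>) + p f (p g (xi_map A G \<xi>))"
      using fg eta_swap[OF \<xi>, of "[]" f g] by (simp add: xi closed form ac_simps)
  next
    fix fs assume fs: "fs \<noteq> []" "set fs \<subseteq> ?J"
      and IH: "\<And>h. h \<in> set fs \<Longrightarrow> p (p f g) h + p g (p f h) = p (p g f) h + p f (p g h)"
    define n where "n = length fs"
    have nth: "fs ! i \<in> ?J" if "i < n" for i using that fs(2) by (auto simp: n_def)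
    \<comment> \<open>\<open>f\<close> and \<open>g\<close> act on different slots\<close>
    define R where "R f g = (\<Sum>i<n. \<Sum>j\<in>{..<n} - {i}. ?\<eta> (fs[i := p g (fs ! i), j := p f (fs ! j)]))" for f g
    have twice: "p f (p g (?\<eta> fs)) =
        (\<Sum>i<n. ?\<eta> (fs[i := p f (p g (fs ! i))])) + R f g + (\<Sum>i<n. ?\<eta> (f # fs[i := p g (fs ! i)]))
        + ?\<eta> (p f g # fs) + (\<Sum>i<n. ?\<eta> (g # fs[i := p f (fs ! i)])) + ?\<eta> (f # g # fs)"
      if fg: "f \<in> ?J" "g \<in> ?J" for f g
    proof -
      have upd: "set (fs[i := p g (fs ! i)]) \<subseteq> ?J" if "i < n" for i
        using that fg fs(2) by (intro update closed nth)
      have inner: "p f (?\<eta> (fs[i := p g (fs ! i)])) = ?\<eta> (fs[i := p f (p g (fs ! i))])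
          + (\<Sum>j\<in>{..<n} - {i}. ?\<eta> (fs[i := p g (fs ! i), j := p f (fs ! j)])) + ?\<eta> (f # fs[i := p g (fs ! i)])"
        if i: "i < n" for i
      proof -
        let ?t = "\<lambda>j. ?\<eta> (fs[i := p g (fs ! i), j := p f (fs[i := p g (fs ! i)] ! j)])"
        have "p f (?\<eta> (fs[i := p g (fs ! i)])) = (\<Sum>j<n. ?t j) + ?\<eta> (f # fs[i := p g (fs ! i)])"
          using eta[OF fg(1) _ upd[OF i]] fs(1) by (simp add: n_def)
        also have "(\<Sum>j<n. ?t j) = ?t i + (\<Sum>j\<in>{..<n} - {i}. ?t j)"
          using i by (intro sum.remove) auto
        also have "?t i = ?\<eta> (fs[i := p f (p g (fs ! i))])" using i by (simp add: n_def)
        also have "(\<Sum>j\<in>{..<n} - {i}. ?t j) = (\<Sum>j\<in>{..<n} - {i}. ?\<eta> (fs[i := p g (fs ! i), j := p f (fs ! j)]))"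
          by (intro sum.cong) auto
        finally show ?thesis .
      qed
      have mem: "?\<eta> (fs[i := p g (fs ! i)]) \<in> ?J" if "i < n" for i
        using upd[OF that] fs(1) by (intro J_space_eta) auto
      have mem': "?\<eta> (g # fs) \<in> ?J" using fg fs(2) by (intro J_space_eta) auto
      have "p f (p g (?\<eta> fs)) = (\<Sum>i<n. p f (?\<eta> (fs[i := p g (fs ! i)]))) + p f (?\<eta> (g # fs))"
      proof -
        have "(\<Sum>i<n. ?\<eta> (fs[i := p g (fs ! i)])) \<in> ?J"
          using mem by (intro fmap.subspace_sum[OF sub]) auto
        then have "p f ((\<Sum>i<n. ?\<eta> (fs[i := p g (fs ! i)])) + ?\<eta> (g # fs))
            = p f (\<Sum>i<n. ?\<eta> (fs[i := p g (fs ! i)])) + p f (?\<eta> (g # fs))"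
          by (rule add[OF fg(1) _ mem'])
        also have "p f (\<Sum>i<n. ?\<eta> (fs[i := p g (fs ! i)])) = (\<Sum>i<n. p f (?\<eta> (fs[i := p g (fs ! i)])))"
          using mem by (intro sum fg) auto
        finally show ?thesis using eta[OF fg(2) fs] by (simp only: n_def)
      qed
      also have "p f (?\<eta> (g # fs)) = ?\<eta> (p f g # fs) + (\<Sum>i<n. ?\<eta> (g # fs[i := p f (fs ! i)])) + ?\<eta> (f # g # fs)"
        using eta[of f "g # fs"] fg fs(2)
        by (simp add: n_def sum.lessThan_Suc_shift del: sum.lessThan_Suc)
      also have "(\<Sum>i<n. p f (?\<eta> (fs[i := p g (fs ! i)]))) =
          (\<Sum>i<n. ?\<eta> (fs[i := p f (p g (fs ! i))])) + R f g + (\<Sum>i<n. ?\<eta> (f # fs[i := p g (fs ! i)]))"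
        unfolding R_def by (simp add: inner sum.distrib)
      finally show ?thesis by (simp only: add_ac)
    qed
    have R: "R g f = R f g"
    proof -
      have "R g f = (\<Sum>i<n. \<Sum>j<n. if j = i then 0 else ?\<eta> (fs[i := p f (fs ! i), j := p g (fs ! j)]))"
        unfolding R_def by (intro sum.cong refl sum.mono_neutral_cong_left) auto
      also have "\<dots> = (\<Sum>j<n. \<Sum>i<n. if j = i then 0 else ?\<eta> (fs[i := p f (fs ! i), j := p g (fs ! j)]))"
        by (rule sum.swap)
      also have "\<dots> = R f g"
        unfolding R_def by (intro sum.cong refl sum.mono_neutral_cong_right) (auto simp: list_update_swap)
      finally show ?thesis .
    qed
    have slot: "?\<eta> (fs[i := p (p f g) (fs ! i)]) + ?\<eta> (fs[i := p g (p f (fs ! i))]) =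
        ?\<eta> (fs[i := p (p g f) (fs ! i)]) + ?\<eta> (fs[i := p f (p g (fs ! i))])" if "i < n" for i
    proof -
      have "fs ! i \<in> set fs" using that by (simp add: n_def)
      then have slot_IH: "p (p f g) (fs ! i) + p g (p f (fs ! i)) = p (p g f) (fs ! i) + p f (p g (fs ! i))"
        by (rule IH)
      have "set fs \<subseteq> form_maps A G" using fs(2) form by auto
      then have "?\<eta> (fs[i := a + b]) = ?\<eta> (fs[i := a]) + ?\<eta> (fs[i := b])" if "a \<in> ?J" "b \<in> ?J" for a b
        using eta_add[OF \<xi>] that form \<open>i < n\<close> by (simp add: n_def)
      then show ?thesis using slot_IH nth[OF that] fg by (metis closed)
    qed
    have single: "p k (?\<eta> fs) = (\<Sum>i<n. ?\<eta> (fs[i := p k (fs ! i)])) + ?\<eta> (k # fs)" if "k \<in> ?J" for k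
      using eta[OF that fs] by (simp add: n_def)
    have "(\<Sum>i<n. ?\<eta> (fs[i := p (p f g) (fs ! i)])) + (\<Sum>i<n. ?\<eta> (fs[i := p g (p f (fs ! i))])) =
        (\<Sum>i<n. ?\<eta> (fs[i := p (p g f) (fs ! i)])) + (\<Sum>i<n. ?\<eta> (fs[i := p f (p g (fs ! i))]))"
      unfolding sum.distrib[symmetric] using slot by (intro sum.cong) auto
    moreover have "?\<eta> (f # g # fs) = ?\<eta> (g # f # fs)"
      using fs(2) form fg by (intro eta_swap \<xi>) auto
    ultimately show "p (p f g) (?\<eta> fs) + p g (p f (?\<eta> fs)) = p (p g f) (?\<eta> fs) + p f (p g (?\<eta> fs))"
      unfolding twice[OF fg] twice[OF fg(2,1)] single[OF closed[OF fg]] single[OF closed[OF fg(2,1)]] R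
      by (simp add: algebra_simps)
  qed
qed

end

theorem proposition3p4:
  fixes A :: "('a, 'e::real_inner) chart set"
    and G :: "('a, 'e) cot set"
    and \<xi> :: "(('a, 'e) cot, 'e \<times> 'e) field"
    and tri :: "('a, 'e) fmap \<Rightarrow> ('a, 'e) fmap \<Rightarrow> ('a, 'e) fmap"
  assumes "smooth_manifold A"
    and "tubular_nbhd A G"
    and "\<xi> \<in> one_forms (cot_atlas A) G"
    and "is_triangle_product A G \<xi> tri"
  shows "pre_lie_algebra (J_space A G \<xi>) tri"
proof -
  obtain B :: "'e set" where "finite B" "span B = UNIV"
    using assms(1) by (auto simp: smooth_manifold_def)
  then obtain E :: "'e set" where "frame E" using frame_exists by blast
  then interpret cotangent_bundle A G E
    using assms(1,2) by unfold_locales (simp_all add: smooth_manifold_def tubular_nbhd_def)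
  have "tri (tri f g) h - tri f (tri g h) = tri (tri g f) h - tri g (tri f h)"
    if "f \<in> J_space A G \<xi>" "g \<in> J_space A G \<xi>" "h \<in> J_space A G \<xi>" for f g h
    using triangle_pre_Lie[OF assms(3,4) that] by (simp add: algebra_simps)
  then show ?thesis
    using assms(4) J_space_subspace by (simp add: pre_lie_algebra_def is_triangle_product_def)
qed

end
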